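(* Let $0<\alpha<\beta$ be real numbers such that $\beta^4-3\alpha^4<2\alpha^3\beta$, and let $\nu$ be a probability measure supported on $[\alpha,\beta]$. If $$t\ge D_{\alpha,\beta}:=\frac{2\beta^2(\alpha+\beta)^2\pi}{\sqrt{4\alpha^6\beta^2-(3\alpha^4-\beta^4)^2}},$$ then the free multiplicative convolution $\sigma_t\boxtimes\nu$ is log-unimodal.
   Context: $\mathbb{R}_+=(0,\infty)$. Unimodality: a positive Borel measure $\mu$ on $\mathbb{R}$ is unimodal with mode $a\in\mathbb{R}$ if $\mu=c\,\delta_a+f(x)\,dx$ where $c\in[0,\infty]$ and $f:\mathbb{R}\to[0,\infty)$ is non-decreasing on $(-\infty,a)$ and non-increasing on $(a,\infty)$. A positive Borel measure $\mu$ on $\mathbb{R}_+$ is log-unimodal with mode $a\in\mathbb{R}_+$ if its push-forward $\log_*\mu$ under $\log:\mathbb{R}_+\to\mathbb{R}$ is unimodal with mode $\log a$; it is log-unimodal if this holds for some $a\in\mathbb{R}_+$. Free multiplicative convolution: for a probability measure $\mu$ on $\mathbb{R}_+$ put $\psi_\mu(z)=\int_0^\infty\frac{xz}{1-xz}\,d\mu(x)$ for $z\in\mathbb{C}\setminus[0,\infty)$ and $\eta_\mu=\psi_\mu/(1+\psi_\mu)$. The function $\eta_\mu$ has an analytic compositional inverse $\eta_\mu^{-1}$ in a neighborhood of $(-\infty,0)$, and the $\Sigma$-transform is $\Sigma_\mu(z)=\eta_\mu^{-1}(z)/z$; it determines $\mu$ uniquely. For probability measures $\mu,\nu$ on $\mathbb{R}_+$,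 $\mu\boxtimes\nu$ is the probability measure on $\mathbb{R}_+$ determined by $\Sigma_{\mu\boxtimes\nu}(z)=\Sigma_\mu(z)\Sigma_\nu(z)$ for $z\in(-\infty,0)$ (equivalently, it is the distribution of $X^{1/2}YX^{1/2}$ for freely independent non-negative self-adjoint operators $X,Y$ affiliated with a finite von Neumann algebra, with distributions $\mu,\nu$). Free positive multiplicative Brownian motion: for $t>0$, $\sigma_t$ is the ($\boxtimes$-infinitely divisible) probability measure on $\mathbb{R}_+$ with $\Sigma_{\sigma_t}(z)=\exp\left(\frac t2\cdot\frac{z+1}{z-1}\right)$. *)

theory Defs
  imports "HOL-Probability.Probability" "HOL-Real_Asymp.Real_Asymp"
begin

section \<open>Unimodality and log-unimodality\<close>

text \<open>
  The constant \<open>c\<close> may be infinite and \<open>0 * \<infinity> = 0\<close> in \<^typ>\<open>ennreal\<close>. The value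
  \<open>f a\<close> is unconstrained.
\<close>

definition unimodal_at :: "real \<Rightarrow> real measure \<Rightarrow> bool" where
  "unimodal_at a \<mu> \<longleftrightarrow>
     sets \<mu> = sets borel \<and>
     (\<exists>(c::ennreal) (f::real \<Rightarrow> real).
        (\<forall>x. 0 \<le> f x) \<and>
        monotone_on {..<a} (\<le>) (\<le>) f \<and>
        monotone_on {a<..} (\<le>) (\<ge>) f \<and>
        (\<forall>A\<in>sets borel.
           emeasure \<mu> A = c * indicator A a + (\<integral>\<^sup>+x. ennreal (f x) * indicator A x \<partial>lborel)))"

text \<open>
  Borel measures on \<open>(0, \<infinity>)\<close> are represented as Borel measures on the real line that give
  no mass to \<open>(-\<infinity>, 0]\<close>, so the values of \<^const>\<open>ln\<close> there are irrelevant.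
\<close>

definition log_unimodal_at :: "real \<Rightarrow> real measure \<Rightarrow> bool" where
  "log_unimodal_at a \<mu> \<longleftrightarrow>
     0 < a \<and> sets \<mu> = sets borel \<and> emeasure \<mu> {..0} = 0 \<and>
     unimodal_at (ln a) (distr \<mu> borel ln)"

definition log_unimodal :: "real measure \<Rightarrow> bool" where
  "log_unimodal \<mu> \<longleftrightarrow> (\<exists>a. log_unimodal_at a \<mu>)"


section \<open>Free multiplicative convolution\<close>

definition prob_on_pos :: "real measure \<Rightarrow> bool" where
  "prob_on_pos \<mu> \<longleftrightarrow> real_distribution \<mu> \<and> emeasure \<mu> {..0} = 0"

definition psi_transform :: "real measure \<Rightarrow> complex \<Rightarrow> complex" where
  "psi_transform \<mu> z = (LINT x:{0<..}|\<mu>. of_real x * z / (1 - of_real x * z))"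

definition eta_transform :: "real measure \<Rightarrow> complex \<Rightarrow> complex" where
  "eta_transform \<mu> z = psi_transform \<mu> z / (1 + psi_transform \<mu> z)"

definition neg_axis :: "complex set" where
  "neg_axis = of_real ` {..<0}"

text \<open>
  The \<open>\<eta>\<close>-transform of a probability measure on \<open>(0, \<infinity>)\<close> restricts to a bijection of the
  negative half-line onto itself (see \<open>bij_betw_eta_transform\<close> below), and its analytic
  inverse near the negative half-line extends the inverse of this bijection. Only the values on
  the negative half-line enter the definition of the convolution.
\<close>

definition eta_inverse :: "real measure \<Rightarrow> complex \<Rightarrow> complex" where
  "eta_inverse \<mu> = the_inv_into neg_axis (eta_transform \<mu>)"

definition Sigma_transform :: "real measure \<Rightarrow> complex \<Rightarrow> complex" where
  "Sigma_transform \<mu> z = eta_inverse \<mu> z / z"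

text \<open>
  A measure is determined by its \<open>\<Sigma>\<close>-transform on the negative half-line; the convolution
  \<open>\<mu> \<boxtimes> \<nu>\<close> and the law \<open>\<sigma>\<^sub>t\<close> are characterised by the following predicates.
\<close>

definition is_free_mult_conv :: "real measure \<Rightarrow> real measure \<Rightarrow> real measure \<Rightarrow> bool" where
  "is_free_mult_conv \<mu> \<nu> \<rho> \<longleftrightarrow>
     prob_on_pos \<mu> \<and> prob_on_pos \<nu> \<and> prob_on_pos \<rho> \<and>
     (\<forall>z\<in>neg_axis. Sigma_transform \<rho> z = Sigma_transform \<mu> z * Sigma_transform \<nu> z)"

definition is_free_mult_brownian :: "real \<Rightarrow> real measure \<Rightarrow> bool" where
  "is_free_mult_brownian t \<sigma> \<longleftrightarrow>
     prob_on_pos \<sigma> \<and>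
     (\<forall>z\<in>neg_axis. Sigma_transform \<sigma> z = exp (of_real (t / 2) * ((z + 1) / (z - 1))))"

definition D_const :: "real \<Rightarrow> real \<Rightarrow> real" where
  "D_const \<alpha> \<beta> =
     2 * \<beta>\<^sup>2 * (\<alpha> + \<beta>)\<^sup>2 * pi / sqrt (4 * \<alpha> ^ 6 * \<beta>\<^sup>2 - (3 * \<alpha> ^ 4 - \<beta> ^ 4)\<^sup>2)"


section \<open>Invertibility of the \<open>\<eta>\<close>-transform on the negative half-line\<close>

lemma prob_on_pos_AE: "prob_on_pos \<mu> \<Longrightarrow> AE x in \<mu>. 0 < x"
  by (rule AE_I[where N = "{..0}"])
     (auto simp: prob_on_pos_def real_distribution_def real_distribution_axioms_def)

context
  fixes \<mu> :: "real measure" and q :: "real \<Rightarrow> real"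
  assumes \<mu>: "prob_on_pos \<mu>"
  defines "q \<equiv> \<lambda>x. LINT u|\<mu>. indicator {0<..} u * (1 / (1 - u * x))"
begin

interpretation real_distribution \<mu>
  using \<mu> by (simp add: prob_on_pos_def)

private lemma integrable_q: "x < 0 \<Longrightarrow> integrable \<mu> (\<lambda>u. indicator {0<..} u * (1 / (1 - u * x)))"
proof (rule integrable_const_bound[where B = 1])
  assume "x < 0"
  then have "0 < u \<Longrightarrow> u * x < 0" for u
    by (simp add: mult_pos_neg)
  then show "AE u in \<mu>. norm (indicator {0<..} u * (1 / (1 - u * x))) \<le> 1"
    by (intro AE_I2) (force split: split_indicator)
qed measurable

private lemma q_pos: assumes x: "x < 0" shows "0 < q x"
proof -
  have "(LINT u|\<mu>. 0) < q x" unfolding q_def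
  proof (rule integral_less_AE_space)
    show "AE u in \<mu>. 0 < indicator {0<..} u * (1 / (1 - u * x))"
      using prob_on_pos_AE[OF \<mu>] by eventually_elim (use x in \<open>simp add: mult_pos_neg less_trans[of _ 0]\<close>)
  qed (use integrable_q[OF x] emeasure_space_1 in auto)
  then show ?thesis by simp
qed

private lemma q_mono: assumes xy: "x < y" "y < 0" shows "q x < q y"
  unfolding q_def
proof (rule integral_less_AE_space)
  show "AE u in \<mu>. indicator {0<..} u * (1 / (1 - u * x)) < indicator {0<..} u * (1 / (1 - u * y))"
    using prob_on_pos_AE[OF \<mu>]
  proof eventually_elim
    case (elim u)
    then have "u * x < u * y" "u * y < 0"
      using xy by (simp_all add: mult_pos_neg)
    then show ?case using elim by (simp add: frac_less2)
  qed
qed (use integrable_q xy emeasure_space_1 in auto)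

private lemma q_tendsto:
  assumes X: "\<And>n. X n < 0" and lim: "\<And>u. 0 < u \<Longrightarrow> (\<lambda>n. 1 / (1 - u * X n)) \<longlonglongrightarrow> g u"
    and [measurable]: "g \<in> borel_measurable borel"
  shows "(\<lambda>n. q (X n)) \<longlonglongrightarrow> (LINT u|\<mu>. indicator {0<..} u * g u)"
  unfolding q_def
proof (rule integral_dominated_convergence[where w = "\<lambda>_. 1"])
  show "AE u in \<mu>. norm (indicator {0<..} u * (1 / (1 - u * X n))) \<le> 1" for n
    using mult_pos_neg[OF _ X[of n]] by (intro AE_I2) (force split: split_indicator)
  show "AE u in \<mu>. (\<lambda>n. indicator {0<..} u * (1 / (1 - u * X n))) \<longlonglongrightarrow> indicator {0<..} u * g u"
    by (intro AE_I2) (auto split: split_indicator intro: lim)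
qed auto

private lemma integral_indicator_pos: "(LINT u|\<mu>. indicator {0<..} u * (c::real)) = c"
proof -
  have "(LINT u|\<mu>. indicator {0<..} u * c) = (LINT u|\<mu>. c)"
  proof (rule integral_cong_AE)
    show "AE u in \<mu>. indicator {0<..} u * c = c"
      using prob_on_pos_AE[OF \<mu>] by eventually_elim simp
  qed auto
  then show ?thesis using prob_space by simp
qed

private lemma q_at_0: "(\<lambda>n. q (- inverse (real (Suc n)))) \<longlonglongrightarrow> 1"
proof -
  have "(\<lambda>n. 1 / (1 - u * (- inverse (real (Suc n))))) \<longlonglongrightarrow> 1 / (1 - u * (- 0))" for u :: real
    by (intro tendsto_intros LIMSEQ_inverse_real_of_nat) auto
  then have "(\<lambda>n. q (- inverse (real (Suc n)))) \<longlonglongrightarrow> (LINT u|\<mu>. indicator {0<..} u * 1)"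
    by (intro q_tendsto) auto
  then show ?thesis by (simp only: integral_indicator_pos)
qed

private lemma q_at_bot: "(\<lambda>n. q (- real (Suc n))) \<longlonglongrightarrow> 0"
proof -
  have "(\<lambda>n. 1 / (1 - u * (- real (Suc n)))) \<longlonglongrightarrow> 0" if "0 < u" for u :: real
    using that by real_asymp
  then have "(\<lambda>n. q (- real (Suc n))) \<longlonglongrightarrow> (LINT u|\<mu>. indicator {0<..} u * 0)"
    by (intro q_tendsto) auto
  then show ?thesis by simp
qed

private lemma q_less_1: assumes x: "x < 0" shows "q x < 1"
proof -
  have "q x < (LINT u|\<mu>. 1)" unfolding q_def
  proof (rule integral_less_AE_space)
    show "AE u in \<mu>. indicator {0<..} u * (1 / (1 - u * x)) < 1"
      using prob_on_pos_AE[OF \<mu>]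
      by eventually_elim (use x in \<open>simp add: mult_pos_neg less_trans[of _ 0]\<close>)
  qed (use integrable_q[OF x] emeasure_space_1 in auto)
  then show ?thesis using prob_space by simp
qed

private lemma q_continuous: "continuous_on {..<0} q"
proof (rule continuous_on_sequentiallyI)
  fix X a assume X: "\<forall>n. X n \<in> {..<0::real}" and a: "a \<in> {..<0}" and Xa: "X \<longlonglongrightarrow> a"
  have "(\<lambda>n. 1 / (1 - u * X n)) \<longlonglongrightarrow> 1 / (1 - u * a)" if "0 < u" for u
    using that a mult_pos_neg[of u a] by (intro tendsto_intros Xa) auto
  then have "(\<lambda>n. q (X n)) \<longlonglongrightarrow> (LINT u|\<mu>. indicator {0<..} u * (1 / (1 - u * a)))"
    using X by (intro q_tendsto) auto
  then show "(\<lambda>n. q (X n)) \<longlonglongrightarrow> q a"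
    by (simp only: q_def)
qed

private lemma eta_transform_neg:
  assumes x: "x < 0" shows "eta_transform \<mu> (of_real x) = of_real (1 - 1 / q x)"
proof -
  have "psi_transform \<mu> (of_real x) = (LINT u|\<mu>. of_real (indicator {0<..} u * (1 / (1 - u * x)) - indicator {0<..} u * 1))"
    unfolding psi_transform_def set_lebesgue_integral_def
  proof (rule Bochner_Integration.integral_cong)
    fix u
    have "u * x / (1 - u * x) = 1 / (1 - u * x) - 1" if "0 < u"
      using mult_pos_neg[OF that x] by (simp add: field_simps)
    then have "0 < u \<Longrightarrow> of_real u * of_real x / (1 - of_real u * of_real x) =
        complex_of_real (1 / (1 - u * x) - 1)"
      by (metis of_real_1 of_real_diff of_real_divide of_real_mult)
    then show "indicat_real {0<..} u *\<^sub>R (of_real u * of_real x / (1 - of_real u * of_real x)) =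
          complex_of_real (indicator {0<..} u * (1 / (1 - u * x)) - indicator {0<..} u * 1)"
      by (simp split: split_indicator)
  qed simp
  also have "\<dots> = of_real (q x - (LINT u|\<mu>. indicator {0<..} u * 1))"
  proof -
    have "integrable \<mu> (\<lambda>u. indicator {0<..} u * (1::real))"
      by (rule integrable_const_bound[where B = 1]) (auto split: split_indicator)
    with integrable_q[OF x] show ?thesis
      unfolding integral_complex_of_real q_def
      by (subst Bochner_Integration.integral_diff) simp_all
  qed
  finally have "psi_transform \<mu> (of_real x) = of_real (q x - 1)"
    by (simp only: integral_indicator_pos)
  then show ?thesis
    using q_pos[OF x] by (simp add: eta_transform_def field_simps)
qed

theorem bij_betw_eta_transform: "bij_betw (eta_transform \<mu>) neg_axis neg_axis"
proof (rule bij_betw_imageI)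
  show "inj_on (eta_transform \<mu>) neg_axis"
  proof (rule inj_onI)
    fix z w assume "z \<in> neg_axis" "w \<in> neg_axis" and eq: "eta_transform \<mu> z = eta_transform \<mu> w"
    then obtain x y where xy: "x < 0" "y < 0" "z = of_real x" "w = of_real y"
      by (auto simp: neg_axis_def)
    have "complex_of_real (1 - 1 / q x) = of_real (1 - 1 / q y)"
      using eq xy by (simp only: eta_transform_neg)
    then have "q x = q y"
      using q_pos[OF xy(1)] q_pos[OF xy(2)] unfolding of_real_eq_iff by simp
    then show "z = w"
      using q_mono[of x y] q_mono[of y x] xy by (cases x y rule: linorder_cases) auto
  qed
  show "eta_transform \<mu> ` neg_axis = neg_axis"
  proof safe
    fix z assume "z \<in> neg_axis"
    then obtain x where x: "x < 0" "z = of_real x" by (auto simp: neg_axis_def)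
    have "1 - 1 / q x < 0" using q_pos[OF x(1)] q_less_1[OF x(1)] by (simp add: field_simps)
    then show "eta_transform \<mu> z \<in> neg_axis"
      unfolding x(2) eta_transform_neg[OF x(1)] neg_axis_def by blast
  next
    fix z assume "z \<in> neg_axis"
    then obtain y where y: "y < 0" "z = of_real y" by (auto simp: neg_axis_def)
    define v where "v = 1 / (1 - y)"
    have v: "0 < v" "v < 1" using y by (auto simp: v_def)
    obtain m where m: "q (- real (Suc m)) < v"
      using order_tendstoD(2)[OF q_at_bot v(1)] by (auto simp: eventually_sequentially)
    obtain n where n: "v < q (- inverse (real (Suc n)))"
      using order_tendstoD(1)[OF q_at_0 v(2)] by (auto simp: eventually_sequentially)
    have "inverse (real (Suc n)) \<le> 1" by (simp add: field_simps)
    then have le: "- real (Suc m) \<le> - inverse (real (Suc n))" by simp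
    have neg: "- inverse (real (Suc n)) < 0" by simp
    have "\<exists>x\<ge>- real (Suc m). x \<le> - inverse (real (Suc n)) \<and> q x = v"
    proof (rule IVT')
      show "continuous_on {- real (Suc m)..- inverse (real (Suc n))} q"
        by (rule continuous_on_subset[OF q_continuous]) (use neg in \<open>auto simp only: atLeastAtMost_iff lessThan_iff\<close>)
    qed (use m n le in auto)
    then obtain x where xle: "x \<le> - inverse (real (Suc n))" and qx: "q x = v" by blast
    have x: "x < 0" using xle neg by (rule order_le_less_trans)
    have "eta_transform \<mu> (of_real x) = z"
      using y by (simp add: eta_transform_neg[OF x] qx v_def)
    then show "z \<in> eta_transform \<mu> ` neg_axis"
      using x unfolding neg_axis_def by blast
  qed
qed

end

end

theory Submission
  imports Defs "HOL-Complex_Analysis.Complex_Analysis"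
begin

text \<open>
  In the coordinate \<open>z = exp (- s)\<close> the function \<open>\<psi> + 1/2\<close> of a measure becomes its transform
  \<open>G\<close> against \<open>coth (s/2) / 2\<close>, taken on the logarithmic scale, and multiplication by \<open>\<Sigma>\<close> of
  \<open>\<sigma>\<^sub>t\<close> becomes \<open>G\<^sub>\<rho> (F s) = G\<^sub>\<nu> s\<close> with \<open>F s = s + t G\<^sub>\<nu> s\<close>, first on the line \<open>Im s = \<pi>\<close> and then by
  analytic continuation. Hence \<open>\<omega> z = z - t G\<^sub>\<rho> z\<close> inverts \<open>F\<close>, and \<open>\<omega>\<close> maps \<open>0 < Im z < \<pi>\<close> onto
  the region of this strip where \<open>Im F > 0\<close>. By Stieltjes inversion the density of \<open>log\<^sub>* \<rho>\<close> at \<open>x\<close> is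
  the limit of \<open>Im \<omega> (x + i\<epsilon>) / (\<pi> t)\<close> for \<open>\<epsilon> \<rightarrow> 0\<close>; the limit exists because \<open>Re \<omega>' > 0\<close>.

  The curve \<open>Im F = \<epsilon>\<close> is a graph over the real axis, so \<open>x \<mapsto> Im \<omega> (x + i\<epsilon>)\<close> is quasiconcave as soon as
  the superlevel sets of \<open>x \<mapsto> \<integral> 1 / (cosh (x - y) - cos v) d(log\<^sub>* \<nu>)(y)\<close> at the height
  \<open>2 (v - \<epsilon>) / (t sin v)\<close> are intervals. With \<open>cos v\<^sub>0 = (3\<alpha>\<^sup>4 - \<beta>\<^sup>4) / (2\<alpha>\<^sup>3\<beta>)\<close>, for \<open>v \<le> v\<^sub>0\<close> the bound
  on \<open>t\<close> puts all of \<open>[log \<alpha>, log \<beta>]\<close> into the superlevel set, and for \<open>v \<ge> v\<^sub>0\<close> the integral is a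
  concave function of \<open>exp x\<close> there; outside that interval it is monotone.
\<close>

section \<open>The kernel \<open>coth (s/2) / 2\<close>\<close>

lemma cos_less_cosh:
  fixes x v :: real
  assumes "0 < v" "v < 2 * pi"
  shows "cos v < cosh x"
proof -
  have "sin (v / 2) > 0" using assms by (intro sin_gt_zero) auto
  then have "cos v < 1" using cos_double_sin[of "v / 2"] by simp
  also have "\<dots> \<le> cosh x" by (rule cosh_real_ge_1)
  finally show ?thesis .
qed

text \<open>The form in \<open>exp (- s)\<close> matches the integrand of \<psi> at
  \<open>z = exp (- s)\<close>; the shift by \<open>1 / 2\<close> makes the function odd.\<close>

definition coth_kernel :: "complex \<Rightarrow> complex" where
  "coth_kernel s = 1 / (1 - exp (- s)) - 1 / 2"

definition coth_kernel' :: "complex \<Rightarrow> complex" where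
  "coth_kernel' s = - exp (- s) / (1 - exp (- s))\<^sup>2"

abbreviation strip :: "real \<Rightarrow> complex set" where
  "strip b \<equiv> {s. 0 < Im s \<and> Im s < b}"

text \<open>The common denominator of all formulas for the kernel and the origin of the Poisson
  denominator \<open>cosh x - cos v\<close>.\<close>

lemma norm_one_minus_exp:
  "(cmod (1 - exp (- s)))\<^sup>2 = 2 * exp (- Re s) * (cosh (Re s) - cos (Im s))"
proof -
  have "exp (- Re s) * exp (Re s) = 1" by (simp flip: exp_add)
  moreover have "(exp (- Re s) * cos (Im s))\<^sup>2 + (exp (- Re s) * sin (Im s))\<^sup>2 = (exp (- Re s))\<^sup>2"
    by (simp add: power_mult_distrib flip: distrib_left)
  moreover have "(cmod (1 - exp (- s)))\<^sup>2 =
      (1 - exp (- Re s) * cos (Im s))\<^sup>2 + (exp (- Re s) * sin (Im s))\<^sup>2"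
    by (simp only: cmod_power2) (simp add: Re_exp Im_exp)
  ultimately show ?thesis
    by (simp add: Re_exp Im_exp cosh_def algebra_simps power2_eq_square)
qed

lemma exp_neq_1_strip:
  assumes "0 < Im s" "Im s < 2 * pi" shows "exp (- s) \<noteq> 1"
proof
  assume "exp (- s) = 1"
  then have "(cmod (1 - exp (- s)))\<^sup>2 = 0" by simp
  then show False using cos_less_cosh[OF assms, of "Re s"] by (simp add: norm_one_minus_exp)
qed

lemma
  assumes "0 < Im s" "Im s < 2 * pi"
  shows Re_coth_kernel: "Re (coth_kernel s) = sinh (Re s) / (2 * (cosh (Re s) - cos (Im s)))"
    and Im_coth_kernel: "Im (coth_kernel s) = - sin (Im s) / (2 * (cosh (Re s) - cos (Im s)))"
proof -
  define r where "r = exp (- Re s)"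
  have r: "0 < r" "exp (Re s) = 1 / r" by (auto simp: r_def exp_minus field_simps)
  define D where "D = cosh (Re s) - cos (Im s)"
  have D: "0 < D" using cos_less_cosh[OF assms] by (simp add: D_def)
  have N: "(Re (1 - exp (-s)))\<^sup>2 + (Im (1 - exp (- s)))\<^sup>2 = 2 * r * D"
    using norm_one_minus_exp[of s] by (simp add: cmod_power2 r_def D_def)
  have DD: "2 * r * D = 1 + r\<^sup>2 - 2 * r * cos (Im s)"
    using r by (simp add: D_def cosh_def r_def[symmetric] field_simps power2_eq_square)
  have SS: "2 * r * sinh (Re s) = 1 - r\<^sup>2"
    using r by (simp add: sinh_def r_def[symmetric] field_simps power2_eq_square)
  have "Re (1 / (1 - exp (- s))) = (1 - r * cos (Im s)) / (2 * r * D)"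
    unfolding Re_divide N by (simp add: Re_exp Im_exp r_def)
  moreover have "Re (coth_kernel s) = Re (1 / (1 - exp (- s))) - 1 / 2"
    by (simp add: coth_kernel_def)
  moreover have "(1 - r * cos (Im s)) / (2 * r * D) - 1 / 2 = (2 * r * sinh (Re s)) / (2 * r * (2 * D))"
    unfolding SS using D r(1) DD by (simp add: field_simps)
  ultimately have "Re (coth_kernel s) = (2 * r * sinh (Re s)) / (2 * r * (2 * D))"
    by simp
  then show "Re (coth_kernel s) = sinh (Re s) / (2 * (cosh (Re s) - cos (Im s)))"
    using r by (simp add: D_def)
  have "Im (1 / (1 - exp (- s))) = - (r * sin (Im s)) / (2 * r * D)"
    unfolding Im_divide N by (simp add: Re_exp Im_exp r_def)
  then show "Im (coth_kernel s) = - sin (Im s) / (2 * (cosh (Re s) - cos (Im s)))"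
    using r by (simp add: D_def coth_kernel_def)
qed

lemma norm_coth_kernel':
  assumes "0 < Im s" "Im s < 2 * pi"
  shows "cmod (coth_kernel' s) = 1 / (2 * (cosh (Re s) - cos (Im s)))"
  using norm_one_minus_exp[of s]
  by (simp add: coth_kernel'_def norm_divide norm_power)

text \<open>Since \<open>coth_kernel' s = - 1 / (2 * (cosh s - 1))\<close> and
  \<open>cosh s - 1\<close> has modulus \<open>C - c\<close>, the two sides differ by a square. The
  bound controls \<open>Re F'\<close> through the same Poisson mean that gives
  \<open>Im F\<close>.\<close>

lemma uminus_Re_coth_kernel'_le:
  assumes "0 < Im s" "Im s < 2 * pi"
  shows "- Re (coth_kernel' s) \<le> cos (Im s) / (2 * (cosh (Re s) - cos (Im s)))"
proof -
  define C c S d where "C = cosh (Re s)" and "c = cos (Im s)" and "S = sinh (Re s)" and "d = sin (Im s)"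
  have D: "0 < C - c" using cos_less_cosh[OF assms] by (simp add: C_def c_def)
  have cosh_s: "Re (cosh s) = C * c" "Im (cosh s) = S * d"
    by (simp_all add: cosh_def sinh_def C_def S_def c_def d_def Re_exp Im_exp field_simps)
  have CS: "S\<^sup>2 = C\<^sup>2 - 1" "d\<^sup>2 = 1 - c\<^sup>2"
    using cosh_square_eq[of "Re s"] by (simp_all add: C_def S_def c_def d_def sin_squared_eq)
  have N: "(C * c - 1)\<^sup>2 + (S * d)\<^sup>2 = (C - c)\<^sup>2"
    unfolding power_mult_distrib CS by (simp add: power2_eq_square algebra_simps)
  have "(1 - exp (- s))\<^sup>2 = exp (- s) * (2 * (cosh s - 1))"
    by (simp add: cosh_def power2_eq_square scaleR_conv_of_real algebra_simps flip: exp_add)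
  then have "coth_kernel' s = (- 1 / 2) *\<^sub>R (1 / (cosh s - 1))"
    by (simp add: coth_kernel'_def scaleR_conv_of_real)
  then have "Re (coth_kernel' s) = - Re (1 / (cosh s - 1)) / 2"
    by simp
  also have "Re (1 / (cosh s - 1)) = (C * c - 1) / (C - c)\<^sup>2"
    by (simp add: Re_divide cosh_s N[symmetric])
  also have "(C * c - 1) / (C - c)\<^sup>2 = c / (C - c) - d\<^sup>2 / (C - c)\<^sup>2"
  proof -
    have "C * c - 1 = c * (C - c) - d\<^sup>2" unfolding CS by (simp add: algebra_simps power2_eq_square)
    then show ?thesis using D by (simp add: diff_divide_distrib power2_eq_square)
  qed
  finally have "- Re (coth_kernel' s) = c / (2 * (C - c)) - d\<^sup>2 / (C - c)\<^sup>2 / 2"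
    by (simp add: diff_divide_distrib mult.commute)
  then show ?thesis by (simp add: C_def c_def)
qed

lemma DERIV_coth_kernel:
  assumes "0 < Im s" "Im s < 2 * pi"
  shows "(coth_kernel has_field_derivative coth_kernel' s) (at s within A)"
  unfolding coth_kernel_def[abs_def] coth_kernel'_def
  using exp_neq_1_strip[OF assms]
  by (auto intro!: derivative_eq_intros simp: power2_eq_square)

lemma measurable_coth_kernel [measurable]:
  "coth_kernel \<in> borel_measurable borel" "coth_kernel' \<in> borel_measurable borel"
proof -
  have [measurable]: "(\<lambda>s::complex. exp (- s)) \<in> borel_measurable borel"
    by (intro borel_measurable_continuous_onI continuous_intros)
  show "coth_kernel \<in> borel_measurable borel" "coth_kernel' \<in> borel_measurable borel"
    unfolding coth_kernel_def[abs_def] coth_kernel'_def[abs_def] by measurable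
qed

lemma cos_le_strip:
  assumes "0 < d" "d \<le> v" "v \<le> 2 * pi - d"
  shows "cos v \<le> cos d"
proof (cases "v \<le> pi")
  case True
  then show ?thesis using assms by (intro cos_monotone_0_pi_le) auto
next
  case False
  have "cos (2 * pi - v) \<le> cos d" using assms False by (intro cos_monotone_0_pi_le) auto
  then show ?thesis by (simp add: cos_diff)
qed

text \<open>A bound uniform on a closed substrip: it serves as Lipschitz constant of the kernel and
  dominates its difference quotients.\<close>

lemma norm_coth_kernel'_le:
  assumes "0 < d" "d < pi" "d \<le> Im s" "Im s \<le> 2 * pi - d"
  shows "cmod (coth_kernel' s) \<le> 1 / (2 * (1 - cos d))"
proof -
  have s: "0 < Im s" "Im s < 2 * pi" using assms by auto
  have "cos (Im s) \<le> cos d" using assms by (intro cos_le_strip) auto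
  moreover have "cos d < 1" using cos_less_cosh[of d 0] assms by simp
  moreover have "1 \<le> cosh (Re s)" by (rule cosh_real_ge_1)
  ultimately show ?thesis
    unfolding norm_coth_kernel'[OF s] by (intro divide_left_mono mult_left_mono mult_pos_pos) auto
qed

lemma sinh_abs_le_cosh: "\<bar>sinh x\<bar> \<le> cosh (x::real)"
  by (simp add: abs_le_iff sinh_def cosh_def)

lemma norm_coth_kernel_le:
  assumes s: "0 < Im s" "Im s < 2 * pi"
  shows "cmod (coth_kernel s) \<le> 2 / (1 - cos (Im s))"
proof -
  define C c where "C = cosh (Re s)" and "c = cos (Im s)"
  have C: "1 \<le> C" "c < 1" using cos_less_cosh[OF s, of 0] by (auto simp: C_def c_def cosh_real_ge_1)
  have "cmod (coth_kernel s) \<le> \<bar>Re (coth_kernel s)\<bar> + \<bar>Im (coth_kernel s)\<bar>"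
    by (rule cmod_le)
  also have "\<dots> \<le> C / (2 * (C - c)) + 1 / (2 * (C - c))"
    unfolding Re_coth_kernel[OF s] Im_coth_kernel[OF s] using C sinh_abs_le_cosh[of "Re s"] abs_sin_le_one[of "Im s"]
    by (intro add_mono) (auto simp: abs_mult C_def c_def abs_divide intro!: divide_right_mono)
  also have "\<dots> \<le> 1 / (1 - c) + 1 / (1 - c)"
  proof (rule add_mono)
    \<comment> \<open>With the denominators cleared the claim is
      \<open>2 * c \<le> (1 + c) * C\<close>, which follows from \<open>1 \<le> C\<close> and
      \<open>2 * c \<le> 1 + c\<close>.\<close>
    have "0 \<le> 1 + c"
      using cos_ge_minus_one[of "Im s"] unfolding c_def by linarith
    with C have "(1 + c) * 1 \<le> (1 + c) * C"
      by (intro mult_left_mono) simp_all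
    then show "C / (2 * (C - c)) \<le> 1 / (1 - c)"
      using C by (simp add: divide_simps) (auto simp: algebra_simps)
    show "1 / (2 * (C - c)) \<le> 1 / (1 - c)" using C by (simp add: frac_le)
  qed
  finally show ?thesis by (simp add: c_def)
qed


section \<open>The transform of a measure on the line\<close>

definition coth_transform :: "real measure \<Rightarrow> complex \<Rightarrow> complex" where
  "coth_transform M s = (LINT y|M. coth_kernel (s - of_real y))"

definition coth_transform' :: "real measure \<Rightarrow> complex \<Rightarrow> complex" where
  "coth_transform' M s = (LINT y|M. coth_kernel' (s - of_real y))"

text \<open>Times \<open>sin v / (2 * pi)\<close> the integrand is the Poisson kernel of the strip
  \<open>0 < Im < pi\<close> for its lower edge.\<close>

definition poisson_mean :: "real measure \<Rightarrow> real \<Rightarrow> real \<Rightarrow> real" where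
  "poisson_mean M v x = (LINT y|M. 1 / (cosh (x - y) - cos v))"

lemma poisson_kernel_bounds:
  assumes "0 < v" "v < 2 * pi"
  shows "0 < 1 / (cosh x - cos v)" "1 / (cosh x - cos v) \<le> 1 / (1 - cos v)"
  using cos_less_cosh[OF assms, of x] cos_less_cosh[OF assms, of 0] cosh_real_ge_1[of x]
  by (auto intro!: divide_left_mono mult_pos_pos)

context real_distribution
begin

lemma integrable_coth_kernel:
  assumes "0 < Im s" "Im s < 2 * pi"
  shows "integrable M (\<lambda>y. coth_kernel (s - of_real y))"
  by (rule integrable_const_bound[where B = "2 / (1 - cos (Im s))"])
     (use norm_coth_kernel_le[of "s - of_real _"] assms in auto)

lemma integrable_coth_kernel':
  assumes "0 < Im s" "Im s < 2 * pi"
  shows "integrable M (\<lambda>y. coth_kernel' (s - of_real y))"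
proof (rule integrable_const_bound[where B = "1 / (2 * (1 - cos (min (Im s) (2 * pi - Im s) / 2)))"])
  show "AE y in M. cmod (coth_kernel' (s - of_real y))
      \<le> 1 / (2 * (1 - cos (min (Im s) (2 * pi - Im s) / 2)))"
    using assms by (intro AE_I2 norm_coth_kernel'_le) (auto simp: min_def field_simps)
qed measurable

lemma integrable_poisson_kernel:
  assumes "0 < v" "v < 2 * pi"
  shows "integrable M (\<lambda>y. 1 / (cosh (x - y) - cos v))"
proof (rule integrable_const_bound[where B = "1 / (1 - cos v)"])
  have "(\<lambda>y::real. cosh (x - y)) \<in> borel_measurable borel"
    by (intro borel_measurable_continuous_onI continuous_intros)
  then show "(\<lambda>y. 1 / (cosh (x - y) - cos v)) \<in> borel_measurable M"
    by measurable
qed (use poisson_kernel_bounds[OF assms] in \<open>auto simp: abs_of_pos\<close>)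

lemma poisson_mean_nonneg:
  assumes "0 < v" "v < 2 * pi" shows "0 \<le> poisson_mean M v x"
  unfolding poisson_mean_def using poisson_kernel_bounds(1)[OF assms]
  by (intro integral_nonneg_AE AE_I2 less_imp_le)

lemma poisson_mean_pos:
  assumes "0 < v" "v < 2 * pi" shows "0 < poisson_mean M v x"
proof -
  have "(LINT y|M. 0) < poisson_mean M v x"
    unfolding poisson_mean_def
    by (rule integral_less_AE_space)
       (use poisson_kernel_bounds(1)[OF assms] integrable_poisson_kernel[OF assms] emeasure_space_1 in auto)
  then show ?thesis by simp
qed

lemma Im_coth_transform:
  assumes "0 < Im s" "Im s < 2 * pi"
  shows "Im (coth_transform M s) = - (sin (Im s) / 2) * poisson_mean M (Im s) (Re s)"
proof -
  have "Im (coth_transform M s) = (LINT y|M. Im (coth_kernel (s - of_real y)))"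
    unfolding coth_transform_def
    by (rule integral_bounded_linear[OF bounded_linear_Im integrable_coth_kernel[OF assms], symmetric])
  also have "\<dots> = (LINT y|M. - (sin (Im s) / 2) * (1 / (cosh (Re s - y) - cos (Im s))))"
    using assms by (intro Bochner_Integration.integral_cong refl) (simp add: Im_coth_kernel)
  finally show ?thesis by (simp only: poisson_mean_def integral_mult_right_zero)
qed

lemma uminus_Re_coth_transform'_le:
  assumes "0 < Im s" "Im s < 2 * pi"
  shows "- Re (coth_transform' M s) \<le> cos (Im s) / 2 * poisson_mean M (Im s) (Re s)"
proof -
  have "- Re (coth_transform' M s) = (LINT y|M. - Re (coth_kernel' (s - of_real y)))"
    unfolding coth_transform'_def
    by (simp add: integral_bounded_linear[OF bounded_linear_Re integrable_coth_kernel'[OF assms], symmetric])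
  also have "\<dots> \<le> (LINT y|M. cos (Im s) / 2 * (1 / (cosh (Re s - y) - cos (Im s))))"
  proof (intro integral_mono)
    show "integrable M (\<lambda>y. - Re (coth_kernel' (s - of_real y)))"
      using integrable_bounded_linear[OF bounded_linear_Re integrable_coth_kernel'[OF assms]] by simp
    show "integrable M (\<lambda>y. cos (Im s) / 2 * (1 / (cosh (Re s - y) - cos (Im s))))"
      by (intro integrable_mult_right integrable_poisson_kernel assms)
    fix y
    show "- Re (coth_kernel' (s - of_real y)) \<le> cos (Im s) / 2 * (1 / (cosh (Re s - y) - cos (Im s)))"
      using uminus_Re_coth_kernel'_le[of "s - of_real y"] assms by simp
  qed
  finally show ?thesis by (simp only: poisson_mean_def integral_mult_right_zero)
qed

text \<open>Differentiation under the integral: the mean value inequality on a convex substrip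
  bounds the difference quotients, and dominated convergence applies.\<close>

lemma DERIV_coth_transform:
  assumes s: "0 < Im s" "Im s < 2 * pi"
  shows "(coth_transform M has_field_derivative coth_transform' M s) (at s)"
proof -
  \<comment> \<open>Half the distance from \<open>Im s\<close> to the boundary values, so that
    \<open>s\<close> is interior to the substrip \<open>A\<close>.\<close>
  define d where "d = min (Im s) (2 * pi - Im s) / 2"
  have d: "0 < d" "d < pi" "d < Im s" "Im s < 2 * pi - d" using s by (auto simp: d_def min_def field_simps)
  define A where "A = {z. d < Im z \<and> Im z < 2 * pi - d}"
  define B where "B = 1 / (2 * (1 - cos d))"
  have A: "open A" "convex A" "s \<in> A"
  proof -
    have "A = {z. d < Im z} \<inter> {z. Im z < 2 * pi - d}" by (auto simp: A_def)
    then show "open A" "convex A"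
      by (auto intro!: open_Int convex_Int simp: open_halfspace_Im_gt open_halfspace_Im_lt convex_halfspace_Im_gt convex_halfspace_Im_lt)
  qed (use d in \<open>auto simp: A_def\<close>)
  have in_strip: "0 < Im z \<and> Im z < 2 * pi" if "z \<in> A" for z
    using that d by (auto simp: A_def)
  have bound: "cmod ((coth_kernel (z - of_real y) - coth_kernel (s - of_real y)) / (z - s)) \<le> B"
    if "z \<in> A" "z \<noteq> s" for z y
  proof -
    have "cmod (coth_kernel (z - of_real y) - coth_kernel (s - of_real y))
        \<le> B * cmod ((z - of_real y) - (s - of_real y))"
    proof (rule field_differentiable_bound[OF A(2)])
      fix w assume "w \<in> A"
      then show "(coth_kernel has_field_derivative coth_kernel' w) (at w within A)"
        using in_strip[of w] by (intro DERIV_coth_kernel) auto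
      show "cmod (coth_kernel' w) \<le> B"
        unfolding B_def using \<open>w \<in> A\<close> d by (intro norm_coth_kernel'_le) (auto simp: A_def)
    qed (use that A(3) in \<open>auto simp: A_def\<close>)
    then show ?thesis using that by (simp add: norm_divide divide_simps)
  qed
  have "((\<lambda>z. (coth_transform M z - coth_transform M s) / (z - s)) \<longlongrightarrow> coth_transform' M s) (at s within A)"
    unfolding tendsto_at_iff_sequentially
  proof (intro allI impI)
    fix X assume X: "\<forall>i. X i \<in> A - {s}" "X \<longlonglongrightarrow> s"
    have "(\<lambda>n. LINT y|M. (coth_kernel (X n - of_real y) - coth_kernel (s - of_real y)) / (X n - s))
        \<longlonglongrightarrow> coth_transform' M s"
      unfolding coth_transform'_def
    proof (rule integral_dominated_convergence[where w = "\<lambda>_. B"])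
      show "AE y in M. (\<lambda>n. (coth_kernel (X n - of_real y) - coth_kernel (s - of_real y)) / (X n - s))
          \<longlonglongrightarrow> coth_kernel' (s - of_real y)"
      proof (rule AE_I2)
        fix y
        have "((\<lambda>z. coth_kernel (z - of_real y)) has_field_derivative coth_kernel' (s - of_real y) * 1) (at s within A)"
          by (rule DERIV_chain2[OF DERIV_coth_kernel]) (use s in \<open>auto intro!: derivative_eq_intros\<close>)
        then show "(\<lambda>n. (coth_kernel (X n - of_real y) - coth_kernel (s - of_real y)) / (X n - s))
          \<longlonglongrightarrow> coth_kernel' (s - of_real y)"
          using X unfolding has_field_derivative_iff tendsto_at_iff_sequentially by (auto simp: o_def)
      qed
      show "AE y in M. cmod ((coth_kernel (X n - of_real y) - coth_kernel (s - of_real y)) / (X n - s)) \<le> B" for n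
        using X by (intro AE_I2 bound) auto
    qed auto
    then show "((\<lambda>z. (coth_transform M z - coth_transform M s) / (z - s)) \<circ> X) \<longlonglongrightarrow> coth_transform' M s"
    proof (rule Lim_transform_eventually, intro always_eventually allI)
      fix n
      show "(LINT y|M. (coth_kernel (X n - of_real y) - coth_kernel (s - of_real y)) / (X n - s))
        = ((\<lambda>z. (coth_transform M z - coth_transform M s) / (z - s)) \<circ> X) n"
        unfolding coth_transform_def using X in_strip[of "X n"] s
        by (simp add: integrable_coth_kernel)
    qed
  qed
  then show ?thesis
    using at_within_open[OF A(3,1)] by (simp add: has_field_derivative_iff)
qed

end


section \<open>Inverting the flow\<close>

lemma concave_sin_0_pi: "concave_on {0..pi} sin"
  by (rule f''_le0_imp_concave[where f' = cos and f'' = "\<lambda>x. - sin x"])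
     (auto intro!: derivative_eq_intros sin_ge_zero)

text \<open>Concavity of \<open>sin\<close> at \<open>v\<close>, taken as the convex combination of
  \<open>e\<close> and \<open>v'\<close> with weight \<open>(v - e) / (v' - e)\<close>, after
  multiplication by \<open>v' - e\<close>.\<close>

lemma sin_chord_le:
  assumes "0 \<le> e" "e \<le> v" "v < v'" "v' \<le> pi"
  shows "(v' - v) * sin e + (v - e) * sin v' \<le> (v' - e) * sin v"
proof -
  define l where "l = (v - e) / (v' - e)"
  have l: "0 \<le> l" "l \<le> 1" using assms by (auto simp: l_def)
  have l': "(v' - e) * l = v - e" using assms by (simp add: l_def)
  then have l'': "(v' - e) * (1 - l) = v' - v" by (simp add: right_diff_distrib)
  have "(1 - l) * e + l * v' = e + (v' - e) * l" by (simp add: algebra_simps)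
  then have v: "(1 - l) *\<^sub>R e + l *\<^sub>R v' = v" by (simp add: l')
  have "(1 - l) * sin e + l * sin v' \<le> sin v"
    using concave_onD[OF concave_sin_0_pi l, of e v'] assms unfolding v by simp
  then have "(v' - e) * ((1 - l) * sin e + l * sin v') \<le> (v' - e) * sin v"
    using assms by (intro mult_left_mono) auto
  then show ?thesis unfolding distrib_left mult.assoc[symmetric] l' l'' .
qed

lemma (in real_distribution) poisson_mean_antimono:
  assumes "0 < v" "v \<le> v'" "v' \<le> pi"
  shows "poisson_mean M v' x \<le> poisson_mean M v x"
  unfolding poisson_mean_def
proof (intro integral_mono integrable_poisson_kernel)
  fix y
  have "cos v' \<le> cos v" using assms by (intro cos_monotone_0_pi_le) auto
  then show "1 / (cosh (x - y) - cos v') \<le> 1 / (cosh (x - y) - cos v)"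
    using cos_less_cosh[of v "x - y"] assms by (intro divide_left_mono) auto
qed (use assms pi_gt_zero in auto)

text \<open>\<open>M\<close> and \<open>R\<close> stand for the laws of \<nu> and \<rho> on the
  logarithmic scale. The line \<open>Im s = pi\<close> corresponds to the negative half-line in
  \<open>exp (- s)\<close>, where the \<Sigma>-transforms are multiplied.\<close>

locale free_brownian_flow = real_distribution M for M :: "real measure" +
  fixes R :: "real measure" and t :: real
  assumes R: "real_distribution R" and t: "0 < t"
    and coth_transform_eq: "\<And>s. Im s = pi \<Longrightarrow>
      coth_transform R (s + of_real t * coth_transform M s) = coth_transform M s"
begin

sublocale R: real_distribution R by (rule R)

definition flow :: "complex \<Rightarrow> complex" where
  "flow s = s + of_real t * coth_transform M s"

text \<open>The imaginary part of \<open>flow\<close> at \<open>x + i v\<close>, as an explicit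
  function of two real variables.\<close>

definition height :: "real \<Rightarrow> real \<Rightarrow> real" where
  "height x v = v - t / 2 * sin v * poisson_mean M v x"

definition inv_flow :: "complex \<Rightarrow> complex" where
  "inv_flow z = z - of_real t * coth_transform R z"

lemma Im_flow:
  assumes "0 < Im s" "Im s < 2 * pi" shows "Im (flow s) = height (Re s) (Im s)"
  using Im_coth_transform[OF assms] by (simp add: flow_def height_def)

lemma DERIV_flow:
  assumes "0 < Im s" "Im s < 2 * pi"
  shows "(flow has_field_derivative 1 + of_real t * coth_transform' M s) (at s)"
  unfolding flow_def[abs_def] by (auto intro!: derivative_eq_intros DERIV_coth_transform assms)

lemma DERIV_inv_flow:
  assumes "0 < Im s" "Im s < 2 * pi"
  shows "(inv_flow has_field_derivative 1 - of_real t * coth_transform' R s) (at s)"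
  unfolding inv_flow_def[abs_def] by (auto intro!: derivative_eq_intros R.DERIV_coth_transform assms)

lemma holomorphic_flow: "flow holomorphic_on strip (2 * pi)"
  using DERIV_flow by (fastforce simp: holomorphic_on_def field_differentiable_def intro: has_field_derivative_at_within)

lemma holomorphic_inv_flow: "inv_flow holomorphic_on strip (2 * pi)"
  using DERIV_inv_flow by (fastforce simp: holomorphic_on_def field_differentiable_def intro: has_field_derivative_at_within)

lemma open_strip: "open (strip b)"
  by (simp add: Collect_conj_eq open_Int open_halfspace_Im_gt open_halfspace_Im_lt)

lemma connected_strip: "connected (strip b)"
  by (simp add: Collect_conj_eq convex_connected convex_Int convex_halfspace_Im_gt convex_halfspace_Im_lt)

lemma height_le: "0 < v \<Longrightarrow> v \<le> pi \<Longrightarrow> height x v \<le> v"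
  using t poisson_mean_nonneg[of v x] sin_ge_zero[of v] by (auto simp: height_def)

lemma height_less: "0 < v \<Longrightarrow> v < pi \<Longrightarrow> height x v < v"
  using t poisson_mean_pos[of v x] sin_gt_zero[of v] by (auto simp: height_def)

lemma height_pi [simp]: "height x pi = pi"
  by (simp add: height_def)

text \<open>Reflection in the line \<open>Im s = pi\<close> flips the sine and keeps the cosine;
  facts about the lower half of the strip carry over to the upper half.\<close>

lemma height_reflect: "height x (2 * pi - v) = 2 * pi - height x v"
  by (simp add: height_def poisson_mean_def sin_diff cos_diff)

text \<open>
  \<open>(v - e) / sin v\<close> increases in \<open>v\<close> because \<open>sin\<close> is concave, whereas the Poisson mean decreases:
  going up a vertical line, \<open>height\<close> crosses the level \<open>e\<close> only once.
\<close>

lemma height_step: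
  assumes "0 \<le> e" "e \<le> v" "0 < v" "v < v'" "v' < pi"
    and "e \<le> height x v" "0 < e \<or> e < height x v"
  shows "e < height x v'"
proof -
  define p p' where "p = t / 2 * poisson_mean M v x" and "p' = t / 2 * poisson_mean M v' x"
  have p: "p' \<le> p" using poisson_mean_antimono[of v v' x] assms t by (simp add: p_def p'_def)
  have s: "0 < sin v" "0 < sin v'" using assms by (auto intro!: sin_gt_zero)
  have h: "height x v = v - p * sin v" "height x v' = v' - p' * sin v'" by (auto simp: height_def p_def p'_def)
  have e: "0 \<le> sin e" "0 < e \<Longrightarrow> 0 < sin e" using assms by (auto intro!: sin_gt_zero sin_ge_zero)
  have "sin v * (p' * sin v') \<le> sin v * (p * sin v')"
    using p s by simp
  moreover have "sin v * (p * sin v') \<le> (v - e) * sin v'"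
    and "e < height x v \<Longrightarrow> sin v * (p * sin v') < (v - e) * sin v'"
    using assms(6) s unfolding h by (auto simp: mult.assoc[symmetric] mult.commute[of "sin v"])
  moreover have "0 \<le> (v' - v) * sin e" "0 < e \<Longrightarrow> 0 < (v' - v) * sin e" using e assms by auto
  moreover have "(v' - v) * sin e + (v - e) * sin v' \<le> sin v * (v' - e)"
    using sin_chord_le[of e v v'] assms by (simp add: mult.commute)
  \<comment> \<open>In the chain of estimates one link is strict: the second if
    \<open>e < height x v\<close>, the third, through \<open>sin e\<close>, if
    \<open>0 < e\<close>.\<close>
  ultimately have "sin v * (p' * sin v') < sin v * (v' - e)"
    using assms(7) by argo
  then show ?thesis using s unfolding h by simp
qed

section \<open>Domains of the flow, analytic continuation and the inverse\<close>

definition flow_domain :: "complex set" where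
  "flow_domain = {s \<in> strip (2 * pi). flow s \<in> strip (2 * pi)}"

text \<open>\<open>flow_domain\<close> crosses the line \<open>Im s = pi\<close>, where the
  functional equation is known; \<open>lower_domain\<close> is the half that \<open>inv_flow\<close>
  parametrises.\<close>

definition lower_domain :: "complex set" where
  "lower_domain = {s \<in> strip pi. 0 < Im (flow s)}"

lemma lower_domain_subset: "lower_domain \<subseteq> flow_domain"
proof
  fix s assume "s \<in> lower_domain"
  then show "s \<in> flow_domain"
    using height_le[of "Im s" "Re s"] by (auto simp: lower_domain_def flow_domain_def Im_flow)
qed

lemma flow_lower_domain: "s \<in> lower_domain \<Longrightarrow> flow s \<in> strip pi"
  using height_less[of "Im s" "Re s"] by (auto simp: lower_domain_def Im_flow)

lemma open_flow_domain: "open flow_domain"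
proof -
  have "flow_domain = strip (2 * pi) \<inter> flow -` strip (2 * pi)" by (auto simp: flow_domain_def)
  then show ?thesis
    by (simp only: continuous_open_preimage[OF holomorphic_on_imp_continuous_on[OF holomorphic_flow] open_strip open_strip])
qed

lemma open_lower_domain: "open lower_domain"
proof -
  have "lower_domain = flow_domain \<inter> strip pi"
    using lower_domain_subset by (auto simp: lower_domain_def flow_domain_def)
  then show ?thesis using open_flow_domain open_strip by auto
qed

lemma height_above:
  assumes "0 < v" "v \<le> v'" "v' \<le> pi" "0 < height x v"
  shows "0 < height x v'" "height x v' < 2 * pi"
proof -
  show "0 < height x v'"
    using assms height_step[of 0 v v' x] by (cases "v = v' \<or> v' = pi") auto
  show "height x v' < 2 * pi" using height_le[of v' x] assms pi_gt_zero by linarith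
qed

text \<open>By the single crossing at level 0, a positive height stays positive on the way up to the
  line \<open>Im s = pi\<close>; reflection handles points above it.\<close>

lemma flow_domain_vertical:
  assumes "s \<in> flow_domain" "v \<in> closed_segment (Im s) pi"
  shows "Complex (Re s) v \<in> flow_domain"
proof -
  have s: "0 < Im s" "Im s < 2 * pi" "0 < height (Re s) (Im s)" "height (Re s) (Im s) < 2 * pi"
    using assms(1) by (auto simp: flow_domain_def Im_flow)
  have "0 < v \<and> v < 2 * pi \<and> 0 < height (Re s) v \<and> height (Re s) v < 2 * pi"
  proof (cases "Im s \<le> pi")
    case True
    then have v: "Im s \<le> v" "v \<le> pi" using assms(2) by (auto simp: closed_segment_eq_real_ivl)
    then show ?thesis using s height_above[of "Im s" v "Re s"] pi_gt_zero by auto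
  next
    case False
    then have v: "v \<le> Im s" "pi \<le> v" using assms(2) by (auto simp: closed_segment_eq_real_ivl)
    then show ?thesis
      using s height_above[of "2 * pi - Im s" "2 * pi - v" "Re s"] pi_gt_zero
      by (auto simp: height_reflect)
  qed
  then show ?thesis by (auto simp: flow_domain_def Im_flow)
qed

lemma pi_line_in_flow_domain: "Im s = pi \<Longrightarrow> s \<in> flow_domain"
  by (simp add: flow_domain_def Im_flow)

text \<open>Every point is joined by a vertical segment to the line \<open>Im s = pi\<close>, which
  lies in the domain because the height there is \<open>pi\<close>.\<close>

lemma connected_flow_domain: "connected flow_domain"
proof -
  have line: "connected {s. Im s = pi}"
  proof (intro convex_connected)
    have "{s. Im s = pi} = {s. Im s \<le> pi} \<inter> {s. pi \<le> Im s}" by auto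
    then show "convex {s. Im s = pi}" by (simp only: convex_Int convex_halfspace_Im_le convex_halfspace_Im_ge)
  qed
  have "connected_component flow_domain s (\<i> * pi)" if s: "s \<in> flow_domain" for s
  proof (rule connected_component_trans)
    let ?V = "(\<lambda>v. Complex (Re s) v) ` closed_segment (Im s) pi"
    have "connected ?V"
      by (intro connected_continuous_image) (auto simp: Complex_eq intro!: continuous_intros)
    moreover have "?V \<subseteq> flow_domain" using flow_domain_vertical[OF s] by auto
    moreover have "s \<in> ?V" by (rule image_eqI[of _ _ "Im s"]) auto
    moreover have "Complex (Re s) pi \<in> ?V" by auto
    ultimately show "connected_component flow_domain s (Complex (Re s) pi)"
      unfolding connected_component_def by blast
    show "connected_component flow_domain (Complex (Re s) pi) (\<i> * pi)"
      unfolding connected_component_def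
      by (rule exI[of _ "{s. Im s = pi}"]) (use line pi_line_in_flow_domain in auto)
  qed
  then show ?thesis
    unfolding connected_iff_connected_component by (meson connected_component_sym connected_component_trans)
qed

text \<open>Identity theorem: on the line \<open>Im s = pi\<close> the equation is the locale
  assumption, and the line accumulates inside the connected domain.\<close>

lemma inv_flow_flow:
  assumes "s \<in> flow_domain" shows "inv_flow (flow s) = s"
proof -
  define U where "U = {s. Im s = pi}"
  have lim: "\<i> * pi islimpt U"
    unfolding islimpt_sequential
  proof (intro exI[of _ "\<lambda>n. Complex (inverse (real (Suc n))) pi"] conjI allI)
    have "(\<lambda>n. Complex (inverse (real (Suc n))) pi) \<longlonglongrightarrow> Complex 0 pi"
      by (intro tendsto_Complex LIMSEQ_inverse_real_of_nat tendsto_const)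
    also have "Complex 0 pi = \<i> * pi" by (simp add: complex_eq_iff)
    finally show "(\<lambda>n. Complex (inverse (real (Suc n))) pi) \<longlonglongrightarrow> \<i> * pi" .
  qed (auto simp: U_def complex_eq_iff)
  have hol: "(\<lambda>s. inv_flow (flow s) - s) holomorphic_on flow_domain"
  proof (intro holomorphic_intros)
    have "(inv_flow \<circ> flow) holomorphic_on flow_domain"
      by (rule holomorphic_on_compose_gen[where t = "strip (2 * pi)"])
         (auto simp: flow_domain_def intro: holomorphic_on_subset[OF holomorphic_flow] holomorphic_inv_flow)
    then show "(\<lambda>s. inv_flow (flow s)) holomorphic_on flow_domain" by (simp add: o_def)
  qed
  have zero: "inv_flow (flow z) - z = 0" if "z \<in> U" for z
    using coth_transform_eq[of z] that by (simp add: U_def inv_flow_def flow_def)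
  have sub: "U \<subseteq> flow_domain" "\<i> * pi \<in> flow_domain"
    using pi_line_in_flow_domain by (auto simp: U_def)
  have "inv_flow (flow s) - s = 0"
    by (rule analytic_continuation[OF hol open_flow_domain connected_flow_domain sub lim zero assms])
  then show ?thesis by simp
qed

lemma Im_inv_flow:
  assumes "0 < Im z" "Im z < 2 * pi"
  shows "Im (inv_flow z) = Im z + t / 2 * sin (Im z) * poisson_mean R (Im z) (Re z)"
  using R.Im_coth_transform[OF assms] by (simp add: inv_flow_def)

lemma Im_inv_flow_gt:
  assumes "z \<in> strip pi" shows "Im z < Im (inv_flow z)"
  using assms t R.poisson_mean_pos[of "Im z" "Re z"] sin_gt_zero[of "Im z"] by (simp add: Im_inv_flow)

text \<open>The right side uses only conditions that are closed in the strip. The boundary value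
  \<open>Im (inv_flow z) = pi\<close> cannot occur, because \<open>flow\<close> keeps the line
  \<open>Im s = pi\<close> invariant and \<open>Im z < pi\<close>.\<close>

lemma flow_image_eq:
  "flow ` lower_domain = {z \<in> strip pi. Im (inv_flow z) \<le> pi \<and> flow (inv_flow z) = z}"
proof (intro equalityI subsetI)
  fix z assume "z \<in> flow ` lower_domain"
  then show "z \<in> {z \<in> strip pi. Im (inv_flow z) \<le> pi \<and> flow (inv_flow z) = z}"
    using flow_lower_domain lower_domain_subset by (auto simp: inv_flow_flow subset_iff lower_domain_def)
next
  fix z assume z: "z \<in> {z \<in> strip pi. Im (inv_flow z) \<le> pi \<and> flow (inv_flow z) = z}"
  then have pos: "0 < Im (inv_flow z)" using Im_inv_flow_gt[of z] by auto
  have "Im (inv_flow z) \<noteq> pi"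
  proof
    assume "Im (inv_flow z) = pi"
    then have "Im z = pi" using z Im_flow[of "inv_flow z"] by auto
    then show False using z by auto
  qed
  then have "inv_flow z \<in> lower_domain" using z pos by (auto simp: lower_domain_def)
  then show "z \<in> flow ` lower_domain" using z by (auto intro!: image_eqI[of _ _ "inv_flow z"])
qed

text \<open>The image is open by invariance of domain and relatively closed by \<open>flow_image_eq\<close>.\<close>

lemma flow_image: "flow ` lower_domain = strip pi"
proof -
  have sub: "strip pi \<subseteq> strip (2 * pi)" "lower_domain \<subseteq> strip (2 * pi)" using pi_gt_zero by (auto simp: lower_domain_def)
  have cont_inv: "continuous_on (strip pi) inv_flow"
    using holomorphic_on_imp_continuous_on[OF holomorphic_inv_flow] sub(1) by (rule continuous_on_subset)
  have cont_flow: "continuous_on (strip (2 * pi)) flow"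
    using holomorphic_on_imp_continuous_on[OF holomorphic_flow] .
  have "open (flow ` lower_domain)"
  proof (rule invariance_of_domain[OF _ open_lower_domain])
    show "inj_on flow lower_domain"
      using lower_domain_subset by (intro inj_on_inverseI[where g = inv_flow] inv_flow_flow) auto
  qed (rule continuous_on_subset[OF cont_flow sub(2)])
  moreover have "closedin (top_of_set (strip pi)) (flow ` lower_domain)"
  proof -
    \<comment> \<open>The bound by \<open>pi\<close> keeps \<open>inv_flow z\<close> in the strip on
      which \<open>flow\<close> is continuous, so the equation below defines a closed subset of
      \<open>T\<close>.\<close>
    define T where "T = strip pi \<inter> inv_flow -` {z. Im z \<le> pi}"
    have T: "closedin (top_of_set (strip pi)) T"
      unfolding T_def by (rule continuous_closedin_preimage[OF cont_inv closed_halfspace_Im_le])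
    have "continuous_on T (\<lambda>z. flow (inv_flow z) - z)"
    proof (intro continuous_intros continuous_on_compose2[OF cont_flow])
      show "inv_flow ` T \<subseteq> strip (2 * pi)"
        using Im_inv_flow_gt pi_gt_zero by (fastforce simp: T_def)
    qed (auto simp: T_def intro: continuous_on_subset[OF cont_inv])
    then have "closedin (top_of_set T) {z \<in> T. flow (inv_flow z) - z = 0}"
      by (rule continuous_closedin_preimage_constant)
    also have "{z \<in> T. flow (inv_flow z) - z = 0} = flow ` lower_domain"
      unfolding flow_image_eq T_def by auto
    finally show ?thesis using T by (rule closedin_trans)
  qed
  moreover have "flow ` lower_domain \<subseteq> strip pi" using flow_lower_domain by blast
  moreover have "flow ` lower_domain \<noteq> {}"
  proof -
    obtain e where e: "0 < e" "ball (\<i> * pi) e \<subseteq> flow_domain"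
      using open_flow_domain pi_line_in_flow_domain[of "\<i> * pi"] by (auto simp: open_contains_ball)
    \<comment> \<open>A point slightly below \<open>\<i> * pi\<close>, close enough to remain in the
      open set \<open>flow_domain\<close>.\<close>
    define s where "s = \<i> * of_real (pi - min e pi / 2)"
    have "dist (\<i> * pi) s = \<bar>min e pi / 2\<bar>"
      unfolding s_def dist_norm right_diff_distrib[symmetric] of_real_diff[symmetric] norm_mult norm_of_real by simp
    also have "\<dots> < e" using e pi_gt_zero by (auto simp: min_def)
    finally have "s \<in> flow_domain" using e(2) by auto
    moreover have "0 < Im s" "Im s < pi" using e pi_gt_zero by (auto simp: s_def min_def)
    ultimately have "s \<in> lower_domain" by (auto simp: lower_domain_def flow_domain_def)
    then show ?thesis by auto
  qed
  moreover have "openin (top_of_set (strip pi)) (flow ` lower_domain)"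
    by (simp only: openin_open_eq[OF open_strip] calculation)
  ultimately show ?thesis
    using connected_strip[of pi, unfolded connected_clopen] by blast
qed

lemma inv_flow_in_lower_domain:
  assumes "z \<in> strip pi" shows "inv_flow z \<in> lower_domain" "flow (inv_flow z) = z"
proof -
  obtain s where "s \<in> lower_domain" "z = flow s" using assms flow_image by blast
  then show "inv_flow z \<in> lower_domain" "flow (inv_flow z) = z"
    using lower_domain_subset by (auto simp: inv_flow_flow)
qed

text \<open>With \<open>p\<close> as below, \<open>Re F' \<ge> 1 - p * cos v\<close>, while
  \<open>Im F > 0\<close> says \<open>p * sin v < v\<close>. If \<open>cos v > 0\<close>, then
  \<open>v * cos v \<le> sin v\<close> turns this into \<open>p * cos v < 1\<close>; otherwise
  \<open>p * cos v \<le> 0\<close>.\<close>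

lemma Re_DERIV_flow_pos:
  assumes "s \<in> lower_domain"
  shows "0 < Re (1 + of_real t * coth_transform' M s)"
proof -
  have s: "0 < Im s" "Im s < pi" "0 < height (Re s) (Im s)"
    using assms by (auto simp: lower_domain_def Im_flow)
  define v p where "v = Im s" and "p = t / 2 * poisson_mean M (Im s) (Re s)"
  have p: "p * sin v < v" "0 \<le> p" "0 < sin v"
    using s t poisson_mean_nonneg[of "Im s" "Re s"]
    by (auto simp: height_def p_def v_def mult_ac intro: sin_gt_zero)
  have "t * - Re (coth_transform' M s) \<le> t * (cos (Im s) / 2 * poisson_mean M (Im s) (Re s))"
    using uminus_Re_coth_transform'_le[of s] s t by (intro mult_left_mono) auto
  then have le: "1 - p * cos v \<le> Re (1 + of_real t * coth_transform' M s)"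
    by (simp add: p_def v_def mult_ac)
  have "p * cos v < 1"
  proof (cases "0 < cos v")
    case True
    have "v < pi / 2"
    proof (rule ccontr)
      assume "\<not> v < pi / 2"
      then have "cos v \<le> cos (pi / 2)" using s by (intro cos_monotone_0_pi_le) (auto simp: v_def)
      then show False using True by simp
    qed
    then have "v \<le> tan v" using abs_tan_ge[of v] tan_gt_zero[of v] s by (simp add: v_def)
    then have "v * cos v \<le> sin v" using True by (simp add: tan_def field_simps)
    moreover have "p * cos v * sin v < v * cos v" using p(1) True by (simp add: mult_ac)
    ultimately have "p * cos v * sin v < 1 * sin v" by simp
    then show ?thesis using p(3) by (simp only: mult_less_cancel_right_pos)
  next
    case False
    then have "p * cos v \<le> 0" using p by (intro mult_nonneg_nonpos) auto
    then show ?thesis by simp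
  qed
  with le show ?thesis by linarith
qed

text \<open>By the chain rule this derivative is the reciprocal of \<open>F'\<close> at
  \<open>inv_flow z\<close>, and reciprocals preserve a positive real part.\<close>

lemma Re_DERIV_inv_flow_pos:
  assumes "z \<in> strip pi"
  shows "0 < Re (1 - of_real t * coth_transform' R z)"
proof -
  define a b where "a = 1 + of_real t * coth_transform' M (inv_flow z)" and "b = 1 - of_real t * coth_transform' R z"
  have z: "0 < Im z" "Im z < 2 * pi" using assms pi_gt_zero by auto
  have w: "inv_flow z \<in> lower_domain" by (rule inv_flow_in_lower_domain[OF assms])
  then have w': "0 < Im (inv_flow z)" "Im (inv_flow z) < 2 * pi" using pi_gt_zero by (auto simp: lower_domain_def)
  have "((\<lambda>z. flow (inv_flow z)) has_field_derivative a * b) (at z)"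
    unfolding a_def b_def by (rule DERIV_chain2[OF DERIV_flow[OF w'] DERIV_inv_flow[OF z]])
  moreover have "((\<lambda>z. flow (inv_flow z)) has_field_derivative 1) (at z)"
    by (rule has_field_derivative_transform_within_open[where f = "\<lambda>z. z" and S = "strip pi"])
       (use assms inv_flow_in_lower_domain open_strip in auto)
  ultimately have "a * b = 1" by (rule DERIV_unique)
  then have "b = 1 / a" by (metis nonzero_mult_div_cancel_left mult_zero_left zero_neq_one)
  moreover have "0 < Re a" unfolding a_def by (rule Re_DERIV_flow_pos[OF w])
  ultimately have "0 < Re b" by (simp add: Re_divide sum_power2_gt_zero_iff)
  then show ?thesis by (simp add: b_def)
qed

end


section \<open>Stieltjes inversion\<close>

text \<open>The primitive in \<open>x\<close>, vanishing at 0, of the Poisson kernel of the strip at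
  height \<open>e\<close>, found by the half-angle substitution \<open>tanh (x / 2)\<close>.\<close>

definition poisson_primitive :: "real \<Rightarrow> real \<Rightarrow> real" where
  "poisson_primitive e x = arctan (tanh (x / 2) / tan (e / 2)) / pi"

lemma DERIV_poisson_primitive:
  assumes e: "0 < e" "e < pi"
  shows "(poisson_primitive e has_real_derivative sin e / (2 * pi) * (1 / (cosh x - cos e))) (at x)"
proof -
  define S C s c where "S = sinh (x / 2)" and "C = cosh (x / 2)" and "s = sin (e / 2)" and "c = cos (e / 2)"
  have pos: "0 < s" "0 < c" "0 < C" using e by (auto simp: s_def c_def C_def intro!: sin_gt_zero cos_gt_zero)
  have CS: "C\<^sup>2 = S\<^sup>2 + 1" by (simp add: C_def S_def cosh_square_eq)
  have cs: "c\<^sup>2 = 1 - s\<^sup>2" by (simp add: c_def s_def cos_squared_eq)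
  have sin_e: "sin e = 2 * s * c" and cos_e: "cos e = 1 - 2 * s\<^sup>2"
    using sin_double[of "e / 2"] cos_double_sin[of "e / 2"] by (simp_all add: s_def c_def)
  have cosh_x: "cosh x = 2 * S\<^sup>2 + 1"
    using cosh_double[of "x / 2"] cosh_square_eq[of "x / 2"] by (simp add: S_def)
  have D: "cosh x - cos e = 2 * (S\<^sup>2 + s\<^sup>2)" by (simp add: cosh_x cos_e)
  have pos': "0 < S\<^sup>2 + s\<^sup>2" using pos by (simp add: add_nonneg_pos)
  have tt: "tanh (x / 2) = S / C" "tan (e / 2) = s / c"
    by (simp_all add: tanh_def tan_def S_def C_def s_def c_def)
  have deriv: "(poisson_primitive e has_real_derivative
      inverse (1 + (tanh (x / 2) / tan (e / 2))\<^sup>2) * ((1 - (tanh (x / 2))\<^sup>2) * (1 / 2) / tan (e / 2)) / pi) (at x)"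
    unfolding poisson_primitive_def[abs_def]
    using pos by (auto intro!: derivative_eq_intros simp: tt(2) C_def[symmetric])
  have A: "1 + (S / C / (s / c))\<^sup>2 = (S\<^sup>2 + s\<^sup>2) / (C\<^sup>2 * s\<^sup>2)"
  proof -
    have "C\<^sup>2 * s\<^sup>2 + S\<^sup>2 * c\<^sup>2 = S\<^sup>2 + s\<^sup>2" unfolding CS cs by (simp add: algebra_simps)
    then show ?thesis using pos by (simp add: power_divide power_mult_distrib field_simps)
  qed
  have B: "1 - (S / C)\<^sup>2 = 1 / C\<^sup>2"
  proof -
    have "S\<^sup>2 = C\<^sup>2 - 1" using CS by simp
    then show ?thesis using pos by (simp add: power_divide diff_divide_distrib)
  qed
  have "inverse (1 + (tanh (x / 2) / tan (e / 2))\<^sup>2) * ((1 - (tanh (x / 2))\<^sup>2) * (1 / 2) / tan (e / 2)) / pi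
      = sin e / (2 * pi) * (1 / (cosh x - cos e))"
    unfolding tt A B D sin_e using pos pos' by (simp add: field_simps power2_eq_square)
  with deriv show ?thesis by simp
qed

lemma abs_poisson_primitive_le: "\<bar>poisson_primitive e x\<bar> \<le> 1 / 2"
  using arctan_lbound[of "tanh (x / 2) / tan (e / 2)"] arctan_ubound[of "tanh (x / 2) / tan (e / 2)"]
  by (auto simp: poisson_primitive_def abs_le_iff field_simps)

text \<open>The factor \<open>1 / tan (e / 2)\<close> tends to infinity, so the arctangent tends to
  \<open>pi / 2\<close> with the sign of \<open>x\<close>.\<close>

lemma poisson_primitive_tendsto:
  assumes e: "\<And>n. 0 < e n" "\<And>n. e n < pi" "e \<longlonglongrightarrow> 0"
  shows "(\<lambda>n. poisson_primitive (e n) x) \<longlonglongrightarrow> sgn x / 2"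
proof -
  have pos: "0 < tan (e n / 2)" for n using e by (intro tan_gt_zero) auto
  have "(\<lambda>n. e n / 2) \<longlonglongrightarrow> 0"
    using tendsto_divide[OF e(3) tendsto_const, of 2] by simp
  then have "(\<lambda>n. tan (e n / 2)) \<longlonglongrightarrow> 0"
    using isCont_tendsto_compose[OF isCont_tan, of 0 "\<lambda>n. e n / 2" sequentially] by simp
  then have "filterlim (\<lambda>n. tan (e n / 2)) (at_right 0) sequentially"
    using pos less_imp_neq[OF pos] by (auto simp: filterlim_at intro!: always_eventually)
  then have inv: "filterlim (\<lambda>n. inverse (tan (e n / 2))) at_top sequentially"
    by (rule filterlim_compose[OF filterlim_inverse_at_top_right])
  have eq: "tanh (x / 2) / tan (e n / 2) = tanh (x / 2) * inverse (tan (e n / 2))" for n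
    by (rule divide_inverse)
  consider "x = 0" | "0 < x" | "x < 0" by linarith
  then show ?thesis
  proof cases
    case 1 then show ?thesis by (simp add: poisson_primitive_def)
  next
    case 2
    then have "filterlim (\<lambda>n. tanh (x / 2) * inverse (tan (e n / 2))) at_top sequentially"
      by (intro filterlim_tendsto_pos_mult_at_top[OF tendsto_const _ inv]) auto
    from filterlim_compose[OF tendsto_arctan_at_top this]
    have "(\<lambda>n. arctan (tanh (x / 2) * inverse (tan (e n / 2))) / pi) \<longlonglongrightarrow> (pi / 2) / pi"
      by (intro tendsto_intros) auto
    then show ?thesis using 2 by (simp add: poisson_primitive_def eq)
  next
    case 3
    then have "filterlim (\<lambda>n. tanh (x / 2) * inverse (tan (e n / 2))) at_bot sequentially"
      by (intro filterlim_tendsto_neg_mult_at_bot[OF tendsto_const _ inv]) auto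
    from filterlim_compose[OF tendsto_arctan_at_bot this]
    have "(\<lambda>n. arctan (tanh (x / 2) * inverse (tan (e n / 2))) / pi) \<longlonglongrightarrow> (- (pi / 2)) / pi"
      by (intro tendsto_intros) auto
    then show ?thesis using 3 by (simp add: poisson_primitive_def eq)
  qed
qed

lemma measurable_cosh [measurable]: "(cosh :: real \<Rightarrow> real) \<in> borel_measurable borel"
  by (intro borel_measurable_continuous_onI continuous_intros)

context real_distribution
begin

lemma measurable_poisson_mean [measurable]:
  "poisson_mean M v \<in> borel_measurable borel"
  unfolding poisson_mean_def[abs_def] by measurable

text \<open>Fubini moves the integral over \<open>x\<close> inside, where the fundamental theorem of
  calculus evaluates it.\<close>

lemma nn_integral_poisson_mean:
  assumes e: "0 < e" "e < pi" and ab: "a \<le> b"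
  shows "(\<integral>\<^sup>+x. ennreal (sin e / (2 * pi) * poisson_mean M e x) * indicator {a..b} x \<partial>lborel)
    = (\<integral>\<^sup>+y. ennreal (poisson_primitive e (b - y) - poisson_primitive e (a - y)) \<partial>M)"
proof -
  interpret L: pair_sigma_finite M lborel by unfold_locales
  have e2: "e < 2 * pi" using e by simp
  have s: "0 \<le> sin e" using e by (intro sin_ge_zero) auto
  let ?k = "\<lambda>x y. sin e / (2 * pi) * (1 / (cosh (x - y) - cos e))"
  have k: "0 \<le> ?k x y" for x y
    using poisson_kernel_bounds(1)[OF e(1) e2, of "x - y"] s by auto
  have "(\<integral>\<^sup>+x. ennreal (sin e / (2 * pi) * poisson_mean M e x) * indicator {a..b} x \<partial>lborel)
    = (\<integral>\<^sup>+x. \<integral>\<^sup>+y. ennreal (?k x y) * indicator {a..b} x \<partial>M \<partial>lborel)"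
  proof (intro nn_integral_cong)
    fix x
    have "(\<integral>\<^sup>+y. ennreal (?k x y) \<partial>M) = ennreal (LINT y|M. ?k x y)"
      using k by (intro nn_integral_eq_integral integrable_mult_right integrable_poisson_kernel e e2) auto
    then show "ennreal (sin e / (2 * pi) * poisson_mean M e x) * indicator {a..b} x =
        (\<integral>\<^sup>+y. ennreal (?k x y) * indicator {a..b} x \<partial>M)"
      by (subst nn_integral_multc) (simp_all only: poisson_mean_def integral_mult_right_zero, measurable)
  qed
  also have "\<dots> = (\<integral>\<^sup>+y. \<integral>\<^sup>+x. ennreal (?k x y) * indicator {a..b} x \<partial>lborel \<partial>M)"
    by (intro L.Fubini') measurable
  also have "\<dots> = (\<integral>\<^sup>+y. ennreal (poisson_primitive e (b - y) - poisson_primitive e (a - y)) \<partial>M)"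
  proof (intro nn_integral_cong nn_integral_FTC_Icc ab k)
    fix x y
    have "((\<lambda>x. x - y) has_real_derivative 1) (at x)"
      by (auto intro!: derivative_eq_intros)
    from DERIV_chain2[OF DERIV_poisson_primitive[OF e] this]
    show "((\<lambda>x. poisson_primitive e (x - y)) has_real_derivative ?k x y) (at x)"
      by simp
  qed measurable
  finally show ?thesis .
qed

text \<open>The Poisson smoothings of \<open>M\<close> tend to \<open>M\<close> on intervals, up to
  the weights of the endpoints, and by the uniform bound they also tend to the integral of
  \<open>d\<close>. The same bound excludes atoms, so both measures agree on compact
  intervals.\<close>

lemma stieltjes_inversion:
  assumes e: "\<And>n. 0 < e n" "\<And>n. e n < pi" "e \<longlonglongrightarrow> 0"
    and lim: "\<And>x. (\<lambda>n. sin (e n) / (2 * pi) * poisson_mean M (e n) x) \<longlonglongrightarrow> d x"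
    and bound: "\<And>n x. sin (e n) / (2 * pi) * poisson_mean M (e n) x \<le> B"
  shows "M = density lborel (\<lambda>x. ennreal (d x))"
proof -
  define p where "p n x = sin (e n) / (2 * pi) * poisson_mean M (e n) x" for n x
  have [measurable]: "p n \<in> borel_measurable borel" for n
    unfolding p_def[abs_def] by measurable
  have p0: "0 \<le> p n x" for n x
    using e(1,2)[of n] poisson_mean_nonneg[of "e n" x] by (auto simp: p_def intro!: mult_nonneg_nonneg divide_nonneg_pos sin_ge_zero)
  have plim: "(\<lambda>n. p n x) \<longlonglongrightarrow> d x" for x using lim by (simp add: p_def)
  have pB: "p n x \<le> B" for n x using bound by (simp add: p_def)
  have B: "0 \<le> B" using p0[of 0 0] pB[of 0 0] by simp
  have d [measurable]: "d \<in> borel_measurable borel"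
    by (rule borel_measurable_LIMSEQ_real[OF plim]) auto
  have d0: "0 \<le> d x" for x by (rule LIMSEQ_le_const[OF plim]) (use p0 in auto)
  have dB: "d x \<le> B" for x by (rule LIMSEQ_le_const2[OF plim]) (use pB in auto)
  have [measurable]: "poisson_primitive v \<in> borel_measurable borel" for v
  proof -
    have [measurable]: "(arctan :: real \<Rightarrow> real) \<in> borel_measurable borel"
      "(\<lambda>x::real. tanh (x / 2)) \<in> borel_measurable borel"
      by (auto intro!: borel_measurable_continuous_onI continuous_intros)
    show ?thesis unfolding poisson_primitive_def[abs_def] by measurable
  qed
  \<comment> \<open>The limit of the differences of primitives: for \<open>a < b\<close> it is 1
    inside the interval, \<open>1 / 2\<close> at both endpoints and 0 outside.\<close>
  define J where "J a b y = sgn (b - y) / 2 - sgn (a - y) / (2::real)" for a b y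
  have [measurable]: "J a b \<in> borel_measurable borel" for a b
    unfolding J_def[abs_def] by measurable
  have int_B: "integrable lborel (\<lambda>x. B * indicator {a..b} x)" for a b :: real
    by (intro integrable_mult_right integrable_real_indicator) (auto simp: emeasure_lborel_Icc_eq)
  have int_Icc: "integrable lborel (\<lambda>x. g x * indicator {a..b} x)"
    if g: "g \<in> borel_measurable borel" "\<And>x. 0 \<le> g x" "\<And>x. g x \<le> B" and ab: "a \<le> b" for g and a b :: real
  proof (rule Bochner_Integration.integrable_bound)
    show "integrable lborel (\<lambda>x. B * indicator {a..b} x)" by (rule int_B)
    show "(\<lambda>x. g x * indicator {a..b} x) \<in> borel_measurable lborel" using g(1) by simp
    show "AE x in lborel. norm (g x * indicator {a..b} x) \<le> norm (B * indicator {a..b} x)"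
      using g B by (intro AE_I2) (auto split: split_indicator)
  qed
  note int_d = int_Icc[OF d d0 dB] and int_p = int_Icc[OF _ p0 pB]
  have key: "(LINT y|M. J a b y) = (LINT x|lborel. d x * indicator {a..b} x)" if ab: "a \<le> b" for a b
  proof (rule LIMSEQ_unique)
    let ?q = "\<lambda>n y. poisson_primitive (e n) (b - y) - poisson_primitive (e n) (a - y)"
    have q0: "0 \<le> ?q n y" for n y
    proof -
      have "poisson_primitive (e n) (a - y) \<le> poisson_primitive (e n) (b - y)"
      proof (rule DERIV_nonneg_imp_nondecreasing[where f = "poisson_primitive (e n)"])
        fix x
        have "0 \<le> sin (e n) / (2 * pi) * (1 / (cosh x - cos (e n)))"
          using poisson_kernel_bounds(1)[of "e n" x] sin_ge_zero[of "e n"] e(1,2)[of n] by auto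
        then show "\<exists>z. (poisson_primitive (e n) has_real_derivative z) (at x) \<and> 0 \<le> z"
          using DERIV_poisson_primitive[OF e(1,2)[of n]] by blast
      qed (use ab in simp)
      then show ?thesis by simp
    qed
    have q1: "\<bar>?q n y\<bar> \<le> 1" for n y
      using abs_poisson_primitive_le[of "e n" "b - y"] abs_poisson_primitive_le[of "e n" "a - y"] by linarith
    show "(\<lambda>n. LINT y|M. ?q n y) \<longlonglongrightarrow> (LINT y|M. J a b y)"
    proof (rule integral_dominated_convergence[where w = "\<lambda>_. 1"])
      show "AE y in M. (\<lambda>n. ?q n y) \<longlonglongrightarrow> J a b y"
        unfolding J_def by (intro AE_I2 tendsto_diff poisson_primitive_tendsto e)
    qed (use q1 in auto)
    have eq: "(LINT y|M. ?q n y) = (LINT x|lborel. p n x * indicator {a..b} x)" for n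
    proof -
      have "integrable M (?q n)" by (rule integrable_const_bound[where B = 1]) (use q1 in auto)
      then have "ennreal (LINT y|M. ?q n y) = (\<integral>\<^sup>+y. ennreal (?q n y) \<partial>M)"
        using q0 by (subst nn_integral_eq_integral) auto
      also have "\<dots> = (\<integral>\<^sup>+x. ennreal (p n x) * indicator {a..b} x \<partial>lborel)"
        unfolding p_def by (rule nn_integral_poisson_mean[OF e(1,2) ab, symmetric])
      also have "\<dots> = (\<integral>\<^sup>+x. ennreal (p n x * indicator {a..b} x) \<partial>lborel)"
        by (intro nn_integral_cong) (auto split: split_indicator)
      also have "\<dots> = ennreal (LINT x|lborel. p n x * indicator {a..b} x)"
        using p0 ab by (intro nn_integral_eq_integral int_p AE_I2) auto
      finally show ?thesis
        using p0 q0 by (subst (asm) ennreal_inj) (auto intro!: integral_nonneg_AE AE_I2)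
    qed
    have "(\<lambda>n. LINT x|lborel. p n x * indicator {a..b} x) \<longlonglongrightarrow> (LINT x|lborel. d x * indicator {a..b} x)"
    proof (rule integral_dominated_convergence[where w = "\<lambda>x. B * indicator {a..b} x"])
      show "integrable lborel (\<lambda>x. B * indicator {a..b} x)" by (rule int_B)
    qed (use p0 pB B in \<open>auto intro!: AE_I2 tendsto_mult plim split: split_indicator\<close>)
    then show "(\<lambda>n. LINT y|M. ?q n y) \<longlonglongrightarrow> (LINT x|lborel. d x * indicator {a..b} x)"
      by (simp only: eq)
  qed
  have J_int: "integrable M (J a b)" for a b
    by (rule integrable_const_bound[where B = 1]) (auto simp: J_def sgn_real_def)
  \<comment> \<open>An atom at \<open>a\<close> contributes half its mass to the integral of
    \<open>J a b\<close>, which is at most \<open>B * (b - a)\<close>; then \<open>b\<close> tends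
    to \<open>a\<close>.\<close>
  have atom: "measure M {a} = 0" for a
  proof -
    have le: "measure M {a} \<le> 2 * B * (b - a)" if "a < b" for b
    proof -
      have int_a: "integrable M (\<lambda>y. indicator {a} y / (2::real))"
        by (rule integrable_const_bound[where B = 1]) (auto split: split_indicator)
      have "measure M {a} / 2 = (LINT y|M. indicator {a} y / 2)" by simp
      also have "\<dots> \<le> (LINT y|M. J a b y)"
        using that by (intro integral_mono J_int int_a) (auto simp: J_def sgn_real_def split: split_indicator)
      also have "\<dots> = (LINT x|lborel. d x * indicator {a..b} x)" using key that by simp
      also have "\<dots> \<le> (LINT x|lborel. B * indicator {a..b} x)"
        using that d0 dB B by (intro integral_mono int_d) (auto split: split_indicator)
      also have "\<dots> = B * (b - a)" using that by simp
      finally show ?thesis by simp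
    qed
    have "(\<lambda>n. 2 * B * (a + inverse (real (Suc n)) - a)) \<longlonglongrightarrow> 2 * B * (a + 0 - a)"
      by (intro tendsto_intros LIMSEQ_inverse_real_of_nat)
    then have "measure M {a} \<le> 2 * B * (a + 0 - a)"
      by (rule LIMSEQ_le_const) (intro exI[of _ 0] allI impI le, simp)
    then show ?thesis by (simp add: measure_le_0_iff)
  qed
  have AE_neq: "AE y in M. y \<noteq> a" for a
    by (rule AE_I[where N = "{a}"]) (auto simp: emeasure_eq_measure atom)
  have interval: "emeasure M {a..b} = emeasure (density lborel (\<lambda>x. ennreal (d x))) {a..b}" for a b
  proof (cases "a \<le> b")
    case True
    have "measure M {a..b} = (LINT y|M. indicator {a..b} y)" by simp
    also have "\<dots> = (LINT y|M. J a b y)"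
    proof (rule integral_cong_AE)
      show "AE y in M. indicator {a..b} y = J a b y"
        using AE_neq[of a] AE_neq[of b]
        by eventually_elim (use True in \<open>auto simp: J_def sgn_real_def split: split_indicator\<close>)
    qed auto
    also have "\<dots> = (LINT x|lborel. d x * indicator {a..b} x)" by (rule key[OF True])
    finally have "emeasure M {a..b} = ennreal (LINT x|lborel. d x * indicator {a..b} x)"
      by (simp add: emeasure_eq_measure)
    also have "\<dots> = (\<integral>\<^sup>+x. ennreal (d x * indicator {a..b} x) \<partial>lborel)"
      using d0 by (intro nn_integral_eq_integral[symmetric] int_d True) auto
    also have "\<dots> = (\<integral>\<^sup>+x. ennreal (d x) * indicator {a..b} x \<partial>lborel)"
      by (intro nn_integral_cong) (auto split: split_indicator)
    finally show ?thesis by (simp add: emeasure_density)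
  qed simp
  show ?thesis
  proof (rule measure_eqI_generator_eq[where \<Omega> = UNIV and E = "range (\<lambda>(a, b). {a..b})" and A = "\<lambda>n::nat. {- real n..real n}"])
    show "Int_stable (range (\<lambda>(a, b). {a..b::real}))"
    proof (rule Int_stableI)
      fix a b :: "real set" assume "a \<in> range (\<lambda>(a, b). {a..b})" "b \<in> range (\<lambda>(a, b). {a..b})"
      then obtain p q r s where "a = {p..q}" "b = {r..s}" by auto
      then have "a \<inter> b = (\<lambda>(a, b). {a..b}) (max p r, min q s)" by auto
      then show "a \<inter> b \<in> range (\<lambda>(a, b). {a..b})" by blast
    qed
    have "x \<in> (\<Union>n. {- real n..real n})" for x :: real
    proof -
      obtain n :: nat where "\<bar>x\<bar> \<le> real n" using real_arch_simple by blast
      then have "x \<in> {- real n..real n}" by auto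
      then show ?thesis by blast
    qed
    then show "(\<Union>n. {- real n..real n}) = UNIV" by blast
    show "sets M = sigma_sets UNIV (range (\<lambda>(a, b). {a..b}))"
      using events_eq_borel by (simp add: borel_eq_atLeastAtMost)
    then show "sets (density lborel (\<lambda>x. ennreal (d x))) = sigma_sets UNIV (range (\<lambda>(a, b). {a..b}))"
      using events_eq_borel by simp
  qed (use interval in \<open>auto simp flip: interval\<close>)
qed

end


section \<open>Quasiconcavity of the density\<close>

text \<open>All superlevel sets are intervals. No mode is mentioned, so the property passes to
  pointwise limits without tracking the modes of the approximants.\<close>

definition quasiconcave :: "(real \<Rightarrow> real) \<Rightarrow> bool" where
  "quasiconcave f \<longleftrightarrow> (\<forall>x y z. x \<le> y \<longrightarrow> y \<le> z \<longrightarrow> min (f x) (f z) \<le> f y)"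

lemma quasiconcaveD: "quasiconcave f \<Longrightarrow> x \<le> y \<Longrightarrow> y \<le> z \<Longrightarrow> min (f x) (f z) \<le> f y"
  by (simp add: quasiconcave_def)

lemma quasiconcave_limit:
  assumes "\<And>n. quasiconcave (f n)" "\<And>x. (\<lambda>n. f n x) \<longlonglongrightarrow> g x"
  shows "quasiconcave g"
  unfolding quasiconcave_def
proof (intro allI impI)
  fix x y z :: real assume "x \<le> y" "y \<le> z"
  then have "min (f n x) (f n z) \<le> f n y" for n using assms(1) by (intro quasiconcaveD)
  moreover have "(\<lambda>n. min (f n x) (f n z)) \<longlonglongrightarrow> min (g x) (g z)"
    by (intro tendsto_min assms)
  ultimately show "min (g x) (g z) \<le> g y"
    by (intro LIMSEQ_le[OF _ assms(2)]) auto
qed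

section \<open>Level curves of the height and the density of the convolution\<close>

context free_brownian_flow
begin

definition inv_height :: "real \<Rightarrow> real \<Rightarrow> real" where
  "inv_height e x = Im (inv_flow (Complex x e))"

text \<open>Consequently \<open>(inv_height e x - e) / (pi * t)\<close> is the Poisson smoothing of
  \<open>R\<close> to which \<open>stieltjes_inversion\<close> applies.\<close>

lemma inv_height_eq:
  assumes "0 < e" "e < pi"
  shows "inv_height e x = e + t / 2 * sin e * poisson_mean R e x"
  using Im_inv_flow[of "Complex x e"] assms by (simp add: inv_height_def)

lemma inv_height_bounds:
  assumes "0 < e" "e < pi"
  shows "e < inv_height e x" "inv_height e x < pi"
  using Im_inv_flow_gt[of "Complex x e"] inv_flow_in_lower_domain[of "Complex x e"] assms
  by (auto simp: inv_height_def lower_domain_def)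

text \<open>The horizontal derivative is \<open>Re \<omega>' > 0\<close>, so the image of the line
  \<open>Im z = e\<close> is a graph over the real axis.\<close>

lemma Re_inv_flow_strict_mono:
  assumes e: "0 < e" "e < pi" and "x < y"
  shows "Re (inv_flow (Complex x e)) < Re (inv_flow (Complex y e))"
  using \<open>x < y\<close>
proof (rule DERIV_pos_imp_increasing)
  fix x
  let ?D = "1 - of_real t * coth_transform' R (Complex x e)"
  have "((\<lambda>x. Complex x e) has_vector_derivative 1) (at x)"
    unfolding Complex_eq by (auto intro!: derivative_eq_intros)
  from field_vector_diff_chain_at[OF this DERIV_inv_flow]
  have "((\<lambda>x. inv_flow (Complex x e)) has_vector_derivative 1 * ?D) (at x)"
    using e by (auto simp: o_def)
  from bounded_linear.has_vector_derivative[OF bounded_linear_Re this]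
  have "((\<lambda>x. Re (inv_flow (Complex x e))) has_real_derivative Re ?D) (at x)"
    by (simp add: has_real_derivative_iff_has_vector_derivative)
  then show "\<exists>D. ((\<lambda>x. Re (inv_flow (Complex x e))) has_real_derivative D) (at x) \<and> 0 < D"
    using Re_DERIV_inv_flow_pos[of "Complex x e"] e by auto
qed

text \<open>The vertical derivative of \<open>Im \<omega>\<close> is again
  \<open>Re \<omega>' > 0\<close>. Monotonicity in \<open>e\<close> makes the boundary limit
  exist.\<close>

lemma inv_height_mono:
  assumes "0 < e" "e \<le> e'" "e' < pi"
  shows "inv_height e x \<le> inv_height e' x"
  unfolding inv_height_def
proof (rule DERIV_nonneg_imp_nondecreasing[where f = "\<lambda>e. Im (inv_flow (Complex x e))", OF assms(2)])
  fix v assume v: "e \<le> v" "v \<le> e'"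
  let ?D = "1 - of_real t * coth_transform' R (Complex x v)"
  have "((\<lambda>v. Complex x v) has_vector_derivative \<i>) (at v)"
    unfolding Complex_eq by (auto intro!: derivative_eq_intros)
  from field_vector_diff_chain_at[OF this DERIV_inv_flow]
  have "((\<lambda>v. inv_flow (Complex x v)) has_vector_derivative \<i> * ?D) (at v)"
    using assms v by (auto simp: o_def)
  from bounded_linear.has_vector_derivative[OF bounded_linear_Im this]
  have "((\<lambda>v. Im (inv_flow (Complex x v))) has_real_derivative Re ?D) (at v)"
    by (simp add: has_real_derivative_iff_has_vector_derivative)
  then show "\<exists>D. ((\<lambda>v. Im (inv_flow (Complex x v))) has_real_derivative D) (at v) \<and> 0 \<le> D"
    using Re_DERIV_inv_flow_pos[of "Complex x v"] assms v by (auto intro!: exI[of _ "Re ?D"])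
qed

text \<open>A dip of the curve \<open>height = e\<close> between two higher points is impossible: at
  the level \<open>v\<close> of the lower of these, both outer abscissas have height at most
  \<open>e\<close>, hence so does the middle one; but there the curve has already been
  crossed.\<close>

lemma inv_height_quasiconcave:
  assumes e: "0 < e" "e < pi"
    and convex: "\<And>v x1 x2 x3. e \<le> v \<Longrightarrow> v < pi \<Longrightarrow> x1 \<le> x2 \<Longrightarrow> x2 \<le> x3 \<Longrightarrow>
      height x1 v \<le> e \<Longrightarrow> height x3 v \<le> e \<Longrightarrow> height x2 v \<le> e"
  shows "quasiconcave (inv_height e)"
  unfolding quasiconcave_def
proof (intro allI impI)
  fix x1 x2 x3 :: real assume x: "x1 \<le> x2" "x2 \<le> x3"
  define X where "X x = Re (inv_flow (Complex x e))" for x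
  note W = inv_height_bounds[OF e]
  have h: "height (X x) (inv_height e x) = e" for x
    using inv_flow_in_lower_domain[of "Complex x e"] Im_flow[of "inv_flow (Complex x e)"] e W[of x]
    by (simp add: X_def inv_height_def)
  have mono: "X x \<le> X y" if "x \<le> y" for x y
    using Re_inv_flow_strict_mono[OF e, of x y] that by (cases "x = y") (auto simp: X_def)
  \<comment> \<open>Single crossing in contrapositive form: a height above \<open>e\<close> below
    the curve would persist up to the curve.\<close>
  have below: "height (X x) v \<le> e" if "e \<le> v" "v \<le> inv_height e x" for x v
  proof (rule ccontr)
    assume "\<not> height (X x) v \<le> e"
    then have "e < height (X x) v" "v \<noteq> inv_height e x" using h[of x] by auto
    then have "e < height (X x) (inv_height e x)"
      using that W[of x] e by (intro height_step[of e v]) auto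
    then show False using h by simp
  qed
  show "min (inv_height e x1) (inv_height e x3) \<le> inv_height e x2"
  proof (rule ccontr)
    define v where "v = min (inv_height e x1) (inv_height e x3)"
    assume "\<not> min (inv_height e x1) (inv_height e x3) \<le> inv_height e x2"
    then have lt: "inv_height e x2 < v" unfolding v_def by (rule not_le_imp_less)
    have v: "e \<le> v" "v < pi" using W[of x1] W[of x3] by (auto simp: v_def)
    have "e < height (X x2) v"
      using lt W[of x2] e v h[of x2] by (intro height_step[of e "inv_height e x2"]) auto
    moreover have "height (X x2) v \<le> e"
    proof (rule convex[OF v mono[OF x(1)] mono[OF x(2)]])
      show "height (X x1) v \<le> e" by (rule below[OF v(1)]) (simp add: v_def)
      show "height (X x3) v \<le> e" by (rule below[OF v(1)]) (simp add: v_def)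
    qed
    ultimately show False by simp
  qed
qed

text \<open>For \<open>e\<close> decreasing to 0 the curves decrease to a limit that inherits
  quasiconcavity; \<open>inv_height < pi\<close> gives the uniform bound needed for the
  inversion.\<close>

theorem quasiconcave_density:
  assumes convex: "\<And>e v x1 x2 x3. 0 < e \<Longrightarrow> e \<le> v \<Longrightarrow> v < pi \<Longrightarrow> x1 \<le> x2 \<Longrightarrow> x2 \<le> x3 \<Longrightarrow>
      height x1 v \<le> e \<Longrightarrow> height x3 v \<le> e \<Longrightarrow> height x2 v \<le> e"
  shows "\<exists>f. quasiconcave f \<and> (\<forall>x. 0 \<le> f x) \<and> f \<in> borel_measurable borel \<and>
    R = density lborel (\<lambda>x. ennreal (f x))"
proof -
  define e where "e n = inverse (real (Suc n))" for n
  have e: "0 < e n" "e n < pi" "e \<longlonglongrightarrow> 0" for n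
  proof -
    show "e \<longlonglongrightarrow> 0" unfolding e_def[abs_def] by (rule LIMSEQ_inverse_real_of_nat)
    show "0 < e n" by (simp add: e_def)
    have "e n \<le> 1" by (simp add: e_def field_simps)
    then show "e n < pi" using pi_gt3 by linarith
  qed
  note W = inv_height_bounds[OF e(1,2)]
  have W0: "0 \<le> inv_height (e n) x" for n x
    using W(1)[of n x] e(1)[of n] by linarith
  have "\<exists>L. (\<lambda>n. inv_height (e n) x) \<longlonglongrightarrow> L" for x
  proof -
    have "e m \<le> e n" if "n \<le> m" for m n
      using that by (simp add: e_def field_simps)
    then have "decseq (\<lambda>n. inv_height (e n) x)"
      by (intro decseq_SucI inv_height_mono e) auto
    moreover have "\<forall>n. 0 \<le> inv_height (e n) x" using W0 by blast
    ultimately show ?thesis by (rule decseq_convergent) blast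
  qed
  then obtain L where L: "\<And>x. (\<lambda>n. inv_height (e n) x) \<longlonglongrightarrow> L x" by metis
  have p: "sin (e n) / (2 * pi) * poisson_mean R (e n) x = (inv_height (e n) x - e n) / (pi * t)" for n x
    using t by (simp add: inv_height_eq[OF e(1,2)])
  have lim: "(\<lambda>n. sin (e n) / (2 * pi) * poisson_mean R (e n) x) \<longlonglongrightarrow> L x / (pi * t)" for x
  proof -
    have "(\<lambda>n. (inv_height (e n) x - e n) / (pi * t)) \<longlonglongrightarrow> (L x - 0) / (pi * t)"
      using t by (intro tendsto_intros L e) auto
    then show ?thesis unfolding p by simp
  qed
  show ?thesis
  proof (intro exI conjI allI)
    have "quasiconcave L"
      by (rule quasiconcave_limit[OF inv_height_quasiconcave[OF e(1,2) convex[OF e(1)]] L])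
    then show "quasiconcave (\<lambda>x. L x / (pi * t))"
      using t not_less_iff_gr_or_eq[of "pi * t" 0]
      unfolding quasiconcave_def min_le_iff_disj by (simp add: divide_le_cancel)
    have "0 \<le> L x" for x
      by (rule LIMSEQ_le_const[OF L]) (use W0 in auto)
    then show "0 \<le> L x / (pi * t)" for x using t by simp
    show "(\<lambda>x. L x / (pi * t)) \<in> borel_measurable borel"
      by (rule borel_measurable_LIMSEQ_real[OF lim]) measurable
    show "R = density lborel (\<lambda>x. ennreal (L x / (pi * t)))"
    proof (rule R.stieltjes_inversion[OF e lim])
      show "sin (e n) / (2 * pi) * poisson_mean R (e n) x \<le> pi / (pi * t)" for n x
        unfolding p using W(2)[of n x] e(1)[of n] t by (intro divide_right_mono) auto
    qed
  qed
qed

end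

section \<open>Shape of the Poisson mean of a compactly supported measure\<close>

lemma cosh_le_cosh_abs:
  assumes "\<bar>x\<bar> \<le> \<bar>y\<bar>" shows "cosh x \<le> cosh (y::real)"
  using assms cosh_real_nonneg_le_iff[of "\<bar>x\<bar>" "\<bar>y\<bar>"] by simp

text \<open>
  As a function of \<open>r = exp x\<close>, with \<open>u = exp y\<close>, the kernel \<open>1 / (cosh (x - y) - c)\<close> has a second
  derivative with the sign of \<open>r\<^sup>3 + 2 u\<^sup>3 c - 3 r u\<^sup>2\<close>.
\<close>

lemma concave_poisson_kernel:
  fixes u c \<alpha> \<beta> :: real
  assumes "0 < \<alpha>" "0 < u" "c < 1"
    and cubic: "\<And>r. r \<in> {\<alpha>..\<beta>} \<Longrightarrow> r ^ 3 + 2 * u ^ 3 * c \<le> 3 * r * u\<^sup>2"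
  shows "concave_on {\<alpha>..\<beta>} (\<lambda>r. 2 * u * r / (r\<^sup>2 + u\<^sup>2 - 2 * r * u * c))"
proof (rule f''_le0_imp_concave)
  define D where "D r = r\<^sup>2 + u\<^sup>2 - 2 * r * u * c" for r
  fix r assume r: "r \<in> {\<alpha>..\<beta>}"
  have "D r = (r - u)\<^sup>2 + 2 * r * u * (1 - c)" by (simp add: D_def power2_eq_square algebra_simps)
  moreover have "0 < 2 * r * u * (1 - c)" using assms r by simp
  ultimately have D: "0 < D r" by (simp add: add_nonneg_pos)
  have dD: "(D has_real_derivative 2 * r - 2 * u * c) (at r)"
    unfolding D_def[abs_def] by (auto intro!: derivative_eq_intros)
  have "((\<lambda>r. 2 * u * r / D r) has_real_derivative 2 * u * (u\<^sup>2 - r\<^sup>2) / (D r)\<^sup>2) (at r)"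
    using D by (auto intro!: derivative_eq_intros dD simp: field_simps power2_eq_square D_def)
  then show "((\<lambda>r. 2 * u * r / (r\<^sup>2 + u\<^sup>2 - 2 * r * u * c)) has_real_derivative 2 * u * (u\<^sup>2 - r\<^sup>2) / (r\<^sup>2 + u\<^sup>2 - 2 * r * u * c)\<^sup>2) (at r)"
    by (simp add: D_def)
  have "((\<lambda>r. 2 * u * (u\<^sup>2 - r\<^sup>2) / (D r)\<^sup>2) has_real_derivative
      (2 * u * (- 2 * r) * (D r)\<^sup>2 - 2 * u * (u\<^sup>2 - r\<^sup>2) * (2 * D r * (2 * r - 2 * u * c))) / ((D r)\<^sup>2)\<^sup>2) (at r)"
    using D by (auto intro!: derivative_eq_intros dD simp: power2_eq_square)
  also have "(2 * u * (- 2 * r) * (D r)\<^sup>2 - 2 * u * (u\<^sup>2 - r\<^sup>2) * (2 * D r * (2 * r - 2 * u * c))) / ((D r)\<^sup>2)\<^sup>2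
      = 4 * u * (r ^ 3 + 2 * u ^ 3 * c - 3 * r * u\<^sup>2) / (D r) ^ 3"
  proof -
    have "2 * u * (- 2 * r) * (D r)\<^sup>2 - 2 * u * (u\<^sup>2 - r\<^sup>2) * (2 * D r * (2 * r - 2 * u * c))
       = D r * (4 * u * (- r * D r - (u\<^sup>2 - r\<^sup>2) * (2 * r - 2 * u * c)))"
      by (simp add: power2_eq_square algebra_simps)
    also have "- r * D r - (u\<^sup>2 - r\<^sup>2) * (2 * r - 2 * u * c) = r ^ 3 + 2 * u ^ 3 * c - 3 * r * u\<^sup>2"
      by (simp add: D_def power2_eq_square power3_eq_cube algebra_simps)
    finally show ?thesis using D by (simp add: power2_eq_square power3_eq_cube)
  qed
  finally show "((\<lambda>r. 2 * u * (u\<^sup>2 - r\<^sup>2) / (r\<^sup>2 + u\<^sup>2 - 2 * r * u * c)\<^sup>2) has_real_derivative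
      4 * u * (r ^ 3 + 2 * u ^ 3 * c - 3 * r * u\<^sup>2) / (r\<^sup>2 + u\<^sup>2 - 2 * r * u * c) ^ 3) (at r)"
    by (simp add: D_def)
  show "4 * u * (r ^ 3 + 2 * u ^ 3 * c - 3 * r * u\<^sup>2) / (r\<^sup>2 + u\<^sup>2 - 2 * r * u * c) ^ 3 \<le> 0"
    using cubic[OF r] D assms(2) unfolding D_def by (intro divide_nonpos_pos mult_nonneg_nonpos) auto
qed simp

lemma poisson_kernel_exp:
  assumes "0 < v" "v < 2 * pi"
  shows "1 / (cosh (x - y) - cos v) = 2 * exp y * exp x / ((exp x)\<^sup>2 + (exp y)\<^sup>2 - 2 * exp x * exp y * cos v)"
proof -
  have "(exp x)\<^sup>2 + (exp y)\<^sup>2 - 2 * exp x * exp y * cos v = 2 * exp y * exp x * (cosh (x - y) - cos v)"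
    by (simp add: cosh_def exp_diff power2_eq_square field_simps)
  then show ?thesis by simp
qed

context real_distribution
begin

text \<open>To the left of the support, moving right brings \<open>x\<close> closer to every
  \<open>y\<close> and so raises every kernel value.\<close>

lemma poisson_mean_mono_left:
  assumes supp: "AE y in M. a \<le> y" and v: "0 < v" "v < 2 * pi" and "x1 \<le> x2" "x2 \<le> a"
  shows "poisson_mean M v x1 \<le> poisson_mean M v x2"
  unfolding poisson_mean_def
proof (intro integral_mono_AE integrable_poisson_kernel v)
  show "AE y in M. 1 / (cosh (x1 - y) - cos v) \<le> 1 / (cosh (x2 - y) - cos v)"
    using supp
  proof eventually_elim
    fix y assume "a \<le> y"
    then have "cosh (x2 - y) \<le> cosh (x1 - y)" using assms by (intro cosh_le_cosh_abs) auto
    then show "1 / (cosh (x1 - y) - cos v) \<le> 1 / (cosh (x2 - y) - cos v)"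
      using cos_less_cosh[OF v, of "x2 - y"] by (intro divide_left_mono) auto
  qed
qed

lemma poisson_mean_mono_right:
  assumes supp: "AE y in M. y \<le> b" and v: "0 < v" "v < 2 * pi" and "b \<le> x1" "x1 \<le> x2"
  shows "poisson_mean M v x2 \<le> poisson_mean M v x1"
  unfolding poisson_mean_def
proof (intro integral_mono_AE integrable_poisson_kernel v)
  show "AE y in M. 1 / (cosh (x2 - y) - cos v) \<le> 1 / (cosh (x1 - y) - cos v)"
    using supp
  proof eventually_elim
    fix y assume "y \<le> b"
    then have "cosh (x1 - y) \<le> cosh (x2 - y)" using assms by (intro cosh_le_cosh_abs) auto
    then show "1 / (cosh (x2 - y) - cos v) \<le> 1 / (cosh (x1 - y) - cos v)"
      using cos_less_cosh[OF v, of "x1 - y"] by (intro divide_left_mono) auto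
  qed
qed

text \<open>Two points of the interval are at distance at most \<open>b - a\<close>, where the
  kernel is smallest.\<close>

lemma poisson_mean_ge:
  assumes supp: "AE y in M. a \<le> y \<and> y \<le> b" and v: "0 < v" "v < 2 * pi" and "a \<le> x" "x \<le> b"
  shows "1 / (cosh (b - a) - cos v) \<le> poisson_mean M v x"
proof -
  have "(LINT y|M. 1 / (cosh (b - a) - cos v)) \<le> poisson_mean M v x"
    unfolding poisson_mean_def
  proof (intro integral_mono_AE integrable_poisson_kernel v)
    show "AE y in M. 1 / (cosh (b - a) - cos v) \<le> 1 / (cosh (x - y) - cos v)"
      using supp
    proof eventually_elim
      fix y assume "a \<le> y \<and> y \<le> b"
      then have "cosh (x - y) \<le> cosh (b - a)" using assms by (intro cosh_le_cosh_abs) auto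
      then show "1 / (cosh (b - a) - cos v) \<le> 1 / (cosh (x - y) - cos v)"
        using cos_less_cosh[OF v, of "x - y"] by (intro divide_left_mono) auto
    qed
  qed simp
  then show ?thesis using prob_space by simp
qed

text \<open>The cubic condition makes each kernel concave in \<open>exp x\<close> on the interval;
  the mean inherits this, and a concave function lies above the smaller of its end values.\<close>

lemma poisson_mean_concave:
  assumes supp: "AE y in M. exp y \<in> {\<alpha>..\<beta>}" and \<alpha>: "0 < \<alpha>" and v: "0 < v" "v < 2 * pi"
    and cubic: "\<And>r u. r \<in> {\<alpha>..\<beta>} \<Longrightarrow> u \<in> {\<alpha>..\<beta>} \<Longrightarrow> r ^ 3 + 2 * u ^ 3 * cos v \<le> 3 * r * u\<^sup>2"
    and x: "\<alpha> \<le> exp x1" "x1 \<le> x2" "x2 \<le> x3" "exp x3 \<le> \<beta>"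
  shows "min (poisson_mean M v x1) (poisson_mean M v x3) \<le> poisson_mean M v x2"
proof (cases "x1 = x3")
  case True then show ?thesis using x by auto
next
  case False
  then have lt: "exp x1 < exp x3" using x by simp
  define l where "l = (exp x2 - exp x1) / (exp x3 - exp x1)"
  have l: "0 \<le> l" "l \<le> 1" using x lt by (auto simp: l_def)
  have "(exp x3 - exp x1) * l = exp x2 - exp x1" using lt by (simp add: l_def)
  then have x2: "(1 - l) *\<^sub>R exp x1 + l *\<^sub>R exp x3 = exp x2" by (simp add: algebra_simps)
  have cos: "cos v < 1" using cos_less_cosh[OF v, of 0] by simp
  let ?k = "\<lambda>x y. 1 / (cosh (x - y) - cos v)"
  have "(1 - l) * poisson_mean M v x1 + l * poisson_mean M v x3 = (LINT y|M. (1 - l) * ?k x1 y + l * ?k x3 y)"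
    unfolding poisson_mean_def
    by (subst Bochner_Integration.integral_add) (simp_all only: integral_mult_right_zero integrable_mult_right integrable_poisson_kernel v)
  also have "\<dots> \<le> (LINT y|M. ?k x2 y)"
  proof (intro integral_mono_AE Bochner_Integration.integrable_add integrable_mult_right integrable_poisson_kernel v)
    show "AE y in M. (1 - l) * ?k x1 y + l * ?k x3 y \<le> ?k x2 y"
      using supp
    proof eventually_elim
      fix y assume y: "exp y \<in> {\<alpha>..\<beta>}"
      have "concave_on {\<alpha>..\<beta>} (\<lambda>r. 2 * exp y * r / (r\<^sup>2 + (exp y)\<^sup>2 - 2 * r * exp y * cos v))"
        using \<alpha> cos cubic y by (intro concave_poisson_kernel) auto
      from concave_onD[OF this l, of "exp x1" "exp x3"]
      show "(1 - l) * ?k x1 y + l * ?k x3 y \<le> ?k x2 y"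
        unfolding x2 poisson_kernel_exp[OF v] using x lt by simp
    qed
  qed
  finally have le: "(1 - l) * poisson_mean M v x1 + l * poisson_mean M v x3 \<le> poisson_mean M v x2"
    by (simp add: poisson_mean_def)
  define m where "m = min (poisson_mean M v x1) (poisson_mean M v x3)"
  have "m = (1 - l) * m + l * m" by (simp add: algebra_simps)
  also have "\<dots> \<le> (1 - l) * poisson_mean M v x1 + l * poisson_mean M v x3"
    using l by (intro add_mono mult_left_mono) (auto simp: m_def)
  finally show ?thesis using le by (simp add: m_def)
qed

end


section \<open>Free multiplicative convolution with \<open>\<sigma>\<^sub>t\<close>\<close>

text \<open>One side is the hypothesis, the other is \<open>3 * \<alpha>^4 - \<beta>^4 < 2 *
  \<alpha>^4 < 2 * \<alpha>^3 * \<beta>\<close>. It makes the radicand in \<open>D_const\<close>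
  positive and the arccosine below meaningful.\<close>

lemma abs_gap_less:
  fixes \<alpha> \<beta> :: real
  assumes "0 < \<alpha>" "\<alpha> < \<beta>" and "\<beta> ^ 4 - 3 * \<alpha> ^ 4 < 2 * \<alpha> ^ 3 * \<beta>"
  shows "\<bar>3 * \<alpha> ^ 4 - \<beta> ^ 4\<bar> < 2 * \<alpha> ^ 3 * \<beta>"
proof -
  have "\<alpha> ^ 4 < \<alpha> ^ 3 * \<beta>" using assms by (simp add: power4_eq_xxxx power3_eq_cube)
  moreover have "\<alpha> ^ 4 < \<beta> ^ 4" using assms by (intro power_strict_mono) auto
  ultimately show ?thesis using assms(3) by linarith
qed

lemma D_const_pos:
  assumes "0 < \<alpha>" "\<alpha> < \<beta>" and "\<beta> ^ 4 - 3 * \<alpha> ^ 4 < 2 * \<alpha> ^ 3 * \<beta>"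
  shows "0 < D_const \<alpha> \<beta>"
proof -
  have "\<bar>3 * \<alpha> ^ 4 - \<beta> ^ 4\<bar>\<^sup>2 < (2 * \<alpha> ^ 3 * \<beta>)\<^sup>2"
    by (intro power_strict_mono abs_gap_less assms) auto
  then have "(3 * \<alpha> ^ 4 - \<beta> ^ 4)\<^sup>2 < 4 * \<alpha> ^ 6 * \<beta>\<^sup>2"
    by (simp add: power_mult_distrib flip: power_mult)
  then show ?thesis using assms by (simp add: D_const_def)
qed

lemma (in free_brownian_flow) height_sublevel_convex:
  fixes \<alpha> \<beta> :: real
  assumes \<alpha>\<beta>: "0 < \<alpha>" "\<alpha> < \<beta>" and gap: "\<beta> ^ 4 - 3 * \<alpha> ^ 4 < 2 * \<alpha> ^ 3 * \<beta>"
    and supp: "AE y in M. exp y \<in> {\<alpha>..\<beta>}" and tD: "t \<ge> D_const \<alpha> \<beta>"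
    and e: "0 < e" "e \<le> v" "v < pi"
    and x: "x1 \<le> x2" "x2 \<le> x3" and h: "height x1 v \<le> e" "height x3 v \<le> e"
  shows "height x2 v \<le> e"
proof -
  \<comment> \<open>The threshold that turns sublevel sets of \<open>height\<close> at fixed
    \<open>v\<close> into superlevel sets of the Poisson mean.\<close>
  define k where "k = 2 * (v - e) / (t * sin v)"
  have v: "0 < v" "v < 2 * pi" "0 < sin v" using e by (auto intro!: sin_gt_zero)
  have k: "height x v \<le> e \<longleftrightarrow> k \<le> poisson_mean M v x" for x
    using t v by (simp add: height_def k_def field_simps)
  define a b where "a = ln \<alpha>" and "b = ln \<beta>"
  have ab: "exp a = \<alpha>" "exp b = \<beta>" "a < b" using \<alpha>\<beta> by (auto simp: a_def b_def)
  have supp_a: "AE y in M. a \<le> y" and supp_b: "AE y in M. y \<le> b" and supp_ab: "AE y in M. a \<le> y \<and> y \<le> b"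
    using supp by (eventually_elim, simp add: ab(1,2)[symmetric])+
  have k1: "k \<le> poisson_mean M v x1" "k \<le> poisson_mean M v x3" using h k by auto
  \<comment> \<open>The extreme ratios of \<open>r\<close> to \<open>u\<close> are
    \<open>\<alpha> / \<beta>\<close> and \<open>\<beta> / \<alpha>\<close>; this \<open>c\<close>
    satisfies \<open>2 * c = 3 * (\<alpha> / \<beta>) - (\<beta> / \<alpha>)^3\<close>, the worst
    case of the cubic condition.\<close>
  define c where "c = (3 * \<alpha> ^ 4 - \<beta> ^ 4) / (2 * \<alpha> ^ 3 * \<beta>)"
  have \<alpha>3\<beta>: "0 < 2 * \<alpha> ^ 3 * \<beta>" using \<alpha>\<beta> by simp
  have c: "- 1 < c" "c < 1"
    using abs_gap_less[OF \<alpha>\<beta> gap] \<alpha>3\<beta> by (auto simp: c_def field_simps abs_less_iff)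
  define v0 where "v0 = arccos c"
  have v0: "0 < v0" "v0 < pi" "cos v0 = c" using c arccos_lt_bounded[of c] by (auto simp: v0_def)
  have sin_v0: "0 < sin v0" using v0 by (intro sin_gt_zero)
  have "k \<le> poisson_mean M v x2"
  proof -
    consider "x2 < a" | "b < x2" | "a \<le> x2" "x2 \<le> b" "v \<le> v0" | "a \<le> x2" "x2 \<le> b" "v0 < v" by linarith
    then show ?thesis
    proof cases
      case 1
      then show ?thesis using poisson_mean_mono_left[OF supp_a v(1,2) x(1)] k1 by linarith
    next
      case 2
      then show ?thesis using poisson_mean_mono_right[OF supp_b v(1,2) _ x(2)] k1 by linarith
    next
      case 3
      \<comment> \<open>An upper bound, uniform in \<open>v\<close>, for the Poisson denominator at
        the largest distance \<open>b - a\<close>.\<close>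
      define K where "K = (\<alpha> + \<beta>)\<^sup>2 / (2 * \<alpha> * \<beta>)"
      have "0 < (\<alpha> + \<beta>)\<^sup>2" using \<alpha>\<beta> by (intro zero_less_power) simp
      then have K: "cosh (b - a) + 1 = K" "0 < K"
        using \<alpha>\<beta> by (auto simp: K_def cosh_def exp_diff exp_minus ab field_simps power2_eq_square)
      \<comment> \<open>As \<open>cos v0 = c\<close>, the radicand is a square times
        \<open>1 - (cos v0)^2\<close>. Together with \<open>\<beta> / \<alpha> \<ge> 1\<close> this
        turns the bound on \<open>t\<close> into \<open>2 * pi * K \<le> t * sin v0\<close>.\<close>
      have "sqrt (4 * \<alpha> ^ 6 * \<beta>\<^sup>2 - (3 * \<alpha> ^ 4 - \<beta> ^ 4)\<^sup>2) = 2 * \<alpha> ^ 3 * \<beta> * sin v0"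
      proof (rule real_sqrt_unique)
        have "3 * \<alpha> ^ 4 - \<beta> ^ 4 = 2 * \<alpha> ^ 3 * \<beta> * cos v0" using \<alpha>\<beta> by (simp add: v0 c_def)
        then have "4 * \<alpha> ^ 6 * \<beta>\<^sup>2 - (3 * \<alpha> ^ 4 - \<beta> ^ 4)\<^sup>2 = (2 * \<alpha> ^ 3 * \<beta>)\<^sup>2 * (1 - (cos v0)\<^sup>2)"
          by (simp add: power_mult_distrib algebra_simps flip: power_mult)
        then show "(2 * \<alpha> ^ 3 * \<beta> * sin v0)\<^sup>2 = 4 * \<alpha> ^ 6 * \<beta>\<^sup>2 - (3 * \<alpha> ^ 4 - \<beta> ^ 4)\<^sup>2"
          by (simp add: sin_squared_eq power_mult_distrib)
      qed (use \<alpha>\<beta> sin_v0 in simp)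
      then have "D_const \<alpha> \<beta> * sin v0 = (\<beta> / \<alpha>)\<^sup>2 * (2 * pi * K)"
        using \<alpha>\<beta> sin_v0 by (simp add: D_const_def K_def field_simps power2_eq_square power3_eq_cube)
      moreover have "1 * (2 * pi * K) \<le> (\<beta> / \<alpha>)\<^sup>2 * (2 * pi * K)"
        using \<alpha>\<beta> K by (intro mult_right_mono) (auto intro!: one_le_power)
      moreover have "D_const \<alpha> \<beta> * sin v0 \<le> t * sin v0" using tD sin_v0 by simp
      ultimately have tK: "2 * pi * K \<le> t * sin v0" by linarith
      \<comment> \<open>The chord from 0 shows that \<open>sin v / v\<close> decreases, so its value
        at \<open>v0\<close> bounds it from below for \<open>v \<le> v0\<close>.\<close>
      have sin_le: "v * sin v0 \<le> pi * sin v"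
      proof -
        have "v * sin v0 \<le> v0 * sin v"
          using sin_chord_le[of 0 v v0] v 3 v0 by (cases "v = v0") auto
        also have "\<dots> \<le> pi * sin v" using v v0 by simp
        finally show ?thesis .
      qed
      have cosh_pos: "0 < cosh (b - a) - cos v" using cos_less_cosh[OF v(1,2)] by simp
      have le_K: "cosh (b - a) - cos v \<le> K" using cos_ge_minus_one[of v] K by linarith
      have "sin v0 * (2 * (v - e) * (cosh (b - a) - cos v)) \<le> sin v0 * (2 * v * K)"
        using e le_K cosh_pos v sin_v0 by (intro mult_left_mono mult_mono) auto
      also have "\<dots> = 2 * K * (v * sin v0)" by simp
      also have "\<dots> \<le> 2 * K * (pi * sin v)" using sin_le K by (intro mult_left_mono) auto
      also have "\<dots> = (2 * pi * K) * sin v" by simp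
      also have "\<dots> \<le> (t * sin v0) * sin v" using tK v by (intro mult_right_mono) auto
      also have "\<dots> = sin v0 * (t * sin v)" by simp
      finally have "2 * (v - e) * (cosh (b - a) - cos v) \<le> t * sin v" using sin_v0 by simp
      then have "k \<le> 1 / (cosh (b - a) - cos v)"
        using t v cosh_pos by (simp add: k_def field_simps)
      also have "\<dots> \<le> poisson_mean M v x2" by (rule poisson_mean_ge[OF supp_ab v(1,2) 3(1,2)])
      finally show ?thesis .
    next
      case 4
      have cv: "cos v \<le> c" using cos_monotone_0_pi_le[of v0 v] 4 v0 e by simp
      have cubic: "r ^ 3 + 2 * u ^ 3 * cos v \<le> 3 * r * u\<^sup>2" if "r \<in> {\<alpha>..\<beta>}" "u \<in> {\<alpha>..\<beta>}" for r u
      proof -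
        have ru: "0 < r" "0 < u" using that \<alpha>\<beta> by auto
        have "2 * u ^ 3 * cos v \<le> 2 * u ^ 3 * c" using cv ru by simp
        also have "\<dots> = 3 * u\<^sup>2 * (u * \<alpha> / \<beta>) - (u * \<beta> / \<alpha>) ^ 3"
          using \<alpha>\<beta> by (simp add: c_def field_simps power2_eq_square power3_eq_cube power4_eq_xxxx)
        \<comment> \<open>Each term is estimated separately, the first by the least and the second
          by the greatest possible \<open>r\<close> for the given \<open>u\<close>.\<close>
        also have "\<dots> \<le> 3 * u\<^sup>2 * r - r ^ 3"
        proof (rule diff_mono)
          have "u * \<alpha> \<le> \<beta> * r" "r * \<alpha> \<le> \<beta> * u"
            using that \<alpha>\<beta> by (auto intro!: mult_mono)
          then have "u * \<alpha> / \<beta> \<le> r" "r \<le> u * \<beta> / \<alpha>"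
            using \<alpha>\<beta> by (auto simp: field_simps)
          then show "3 * u\<^sup>2 * (u * \<alpha> / \<beta>) \<le> 3 * u\<^sup>2 * r" "r ^ 3 \<le> (u * \<beta> / \<alpha>) ^ 3"
            using ru by (intro mult_left_mono power_mono; simp)+
        qed
        finally show ?thesis by (simp add: mult_ac)
      qed
      \<comment> \<open>Outer points beyond the support are moved to its ends, which does not lower
        the mean; concavity is available only between the ends.\<close>
      have "k \<le> poisson_mean M v (max x1 a)"
        using k1(1) poisson_mean_mono_left[OF supp_a v(1,2), of x1 a] by (auto simp: max_def)
      moreover have "k \<le> poisson_mean M v (min x3 b)"
        using k1(2) poisson_mean_mono_right[OF supp_b v(1,2), of b x3] by (auto simp: min_def)
      moreover have "min (poisson_mean M v (max x1 a)) (poisson_mean M v (min x3 b)) \<le> poisson_mean M v x2"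
        using 4 x by (intro poisson_mean_concave[OF supp \<alpha>\<beta>(1) v(1,2) cubic]) (auto simp: ab(1,2)[symmetric])
      ultimately show ?thesis by linarith
    qed
  qed
  then show ?thesis by (simp add: k)
qed

section \<open>From quasiconcave densities to unimodality\<close>

lemma nn_integral_not_bounded_below:
  fixes f :: "real \<Rightarrow> real"
  assumes "(\<integral>\<^sup>+x. ennreal (f x) \<partial>lborel) = 1" "0 < c"
    and "\<And>n::nat. \<exists>a. \<forall>x\<in>{a..a + real n}. c \<le> f x"
  shows False
proof -
  obtain n :: nat where n: "1 / c < real n" using reals_Archimedean2 by blast
  obtain a where a: "\<forall>x\<in>{a..a + real n}. c \<le> f x" using assms(3) by blast
  have "ennreal (c * real n) = (\<integral>\<^sup>+x. ennreal c * indicator {a..a + real n} x \<partial>lborel)"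
    using assms(2) by (simp add: nn_integral_cmult ennreal_mult)
  also have "\<dots> \<le> (\<integral>\<^sup>+x. ennreal (f x) \<partial>lborel)"
    using a by (intro nn_integral_mono) (auto split: split_indicator intro: ennreal_leI)
  finally have "ennreal (c * real n) \<le> ennreal 1" using assms(1) by simp
  then have "c * real n \<le> 1" by (subst (asm) ennreal_le_iff) auto
  then show False using n assms(2) by (simp add: field_simps)
qed

text \<open>The mode is the supremum of the points up to which \<open>f\<close> is non-decreasing.
  Past a first descent a quasiconcave function cannot rise again.\<close>

lemma quasiconcave_density_unimodal:
  assumes f: "quasiconcave f" "\<And>x. 0 \<le> f x" and int: "(\<integral>\<^sup>+x. ennreal (f x) \<partial>lborel) = 1"
  obtains a where "monotone_on {..<a} (\<le>) (\<le>) f" "monotone_on {a<..} (\<le>) (\<ge>) f"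
proof -
  define A where "A = {x. \<forall>p q. p \<le> q \<longrightarrow> q \<le> x \<longrightarrow> f p \<le> f q}"
  have anti: "f z \<le> f y" if x: "x \<notin> A" "x \<le> y" "y \<le> z" for x y z
  proof -
    obtain p q where pq: "p \<le> q" "q \<le> x" "f q < f p" using x by (auto simp: A_def not_le)
    have "min (f p) (f z) \<le> f q" "min (f p) (f z) \<le> f y"
      using pq that by (auto intro!: quasiconcaveD[OF f(1)])
    then show ?thesis using pq(3) by linarith
  qed
  obtain x0 where x0: "0 < f x0"
  proof (rule ccontr)
    assume "\<not> thesis"
    then have "f x = 0" for x using that f(2)[of x] by (meson antisym_conv2 not_less)
    then show False using int by simp
  qed
  \<comment> \<open>If \<open>A\<close> were empty or unbounded, \<open>f\<close> would be monotone
    on the whole line and exceed a positive constant on arbitrarily long intervals, against total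
    mass 1.\<close>
  have "A \<noteq> {}"
  proof
    assume "A = {}"
    then have "f z \<le> f y" if "y \<le> z" for y z using anti[of y y z] that by simp
    then have "\<exists>a. \<forall>x\<in>{a..a + real n}. f x0 \<le> f x" for n
      by (intro exI[of _ "x0 - real n"]) auto
    then show False by (rule nn_integral_not_bounded_below[OF int x0])
  qed
  have "bdd_above A"
  proof (rule ccontr)
    assume "\<not> bdd_above A"
    then have "f p \<le> f q" if "p \<le> q" for p q
      using that unfolding bdd_above_def A_def by (smt (verit) mem_Collect_eq)
    then have "\<exists>a. \<forall>x\<in>{a..a + real n}. f x0 \<le> f x" for n
      by (intro exI[of _ x0]) auto
    then show False by (rule nn_integral_not_bounded_below[OF int x0])
  qed
  show thesis
  proof
    show "monotone_on {..<Sup A} (\<le>) (\<le>) f"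
    proof (rule monotone_onI)
      fix p q assume pq: "p \<in> {..<Sup A}" "q \<in> {..<Sup A}" "p \<le> q"
      then obtain x where "x \<in> A" "q < x" using less_cSup_iff[OF \<open>A \<noteq> {}\<close> \<open>bdd_above A\<close>] by auto
      then show "f p \<le> f q" using pq by (auto simp: A_def)
    qed
    show "monotone_on {Sup A<..} (\<le>) (\<ge>) f"
    proof (rule monotone_onI)
      fix p q assume "p \<in> {Sup A<..}" "q \<in> {Sup A<..}" "p \<le> q"
      moreover have "p \<notin> A" using cSup_upper[OF _ \<open>bdd_above A\<close>, of p] calculation by auto
      ultimately show "f q \<le> f p" using anti[of p p q] by auto
    qed
  qed
qed

section \<open>The \<eta>- and \<Sigma>-transforms on the logarithmic scale\<close>

lemma real_distribution_distr_ln: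
  assumes "prob_on_pos \<mu>" shows "real_distribution (distr \<mu> borel ln)"
proof -
  interpret real_distribution \<mu> using assms by (simp add: prob_on_pos_def)
  show ?thesis by (intro real_distribution_distr) auto
qed

text \<open>With \<open>w = x * exp (- s) = exp (- (s - ln x))\<close> the integrand
  \<open>w / (1 - w)\<close> is \<open>1 / (1 - w) - 1\<close>, the kernel at
  \<open>s - ln x\<close> minus \<open>1 / 2\<close>.\<close>

lemma psi_transform_exp:
  assumes \<mu>: "prob_on_pos \<mu>" and s: "0 < Im s" "Im s < 2 * pi"
  shows "psi_transform \<mu> (exp (- s)) = coth_transform (distr \<mu> borel ln) s - 1 / 2"
proof -
  interpret real_distribution \<mu> using \<mu> by (simp add: prob_on_pos_def)
  interpret D: real_distribution "distr \<mu> borel ln" by (rule real_distribution_distr_ln[OF \<mu>])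
  have int: "integrable \<mu> (\<lambda>x. coth_kernel (s - of_real (ln x)))"
    using D.integrable_coth_kernel[OF s] by (subst (asm) integrable_distr_eq) auto
  have eq: "coth_transform (distr \<mu> borel ln) s = (LINT x|\<mu>. coth_kernel (s - of_real (ln x)))"
    unfolding coth_transform_def by (subst integral_distr) auto
  have "psi_transform \<mu> (exp (- s)) = (LINT x|\<mu>. coth_kernel (s - of_real (ln x)) - 1 / 2)"
    unfolding psi_transform_def set_lebesgue_integral_def
  proof (rule integral_cong_AE)
    show "AE x in \<mu>. indicator {0<..} x *\<^sub>R (of_real x * exp (- s) / (1 - of_real x * exp (- s))) =
        coth_kernel (s - of_real (ln x)) - 1 / 2"
      using prob_on_pos_AE[OF \<mu>]
    proof eventually_elim
      fix x :: real assume x: "0 < x"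
      have "exp (- (s - of_real (ln x))) = exp (of_real (ln x)) * exp (- s)"
        by (simp flip: exp_add)
      also have "exp (of_real (ln x)) = complex_of_real x"
        using x by (simp only: exp_of_real exp_ln)
      finally have w: "exp (- (s - of_real (ln x))) = of_real x * exp (- s)" .
      then have "of_real x * exp (- s) \<noteq> 1" using exp_neq_1_strip[of "s - of_real (ln x)"] s by auto
      then show "indicator {0<..} x *\<^sub>R (of_real x * exp (- s) / (1 - of_real x * exp (- s))) =
          coth_kernel (s - of_real (ln x)) - 1 / 2"
        unfolding coth_kernel_def w using x by (simp add: field_simps)
    qed
  qed auto
  also have "\<dots> = coth_transform (distr \<mu> borel ln) s - 1 / 2"
    unfolding eq using int prob_space by (subst Bochner_Integration.integral_diff) auto
  finally show ?thesis .
qed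

lemma eta_transform_exp:
  assumes "prob_on_pos \<mu>" "0 < Im s" "Im s < 2 * pi"
  shows "eta_transform \<mu> (exp (- s)) =
    (coth_transform (distr \<mu> borel ln) s - 1 / 2) / (coth_transform (distr \<mu> borel ln) s + 1 / 2)"
  unfolding eta_transform_def psi_transform_exp[OF assms] by simp

lemma exp_minus_in_neg_axis:
  assumes "Im s = pi" shows "exp (- s) \<in> neg_axis"
proof -
  have "exp (- s) = of_real (- exp (- Re s))"
    using assms by (simp add: complex_eq_iff Re_exp Im_exp)
  then show ?thesis unfolding neg_axis_def by (intro image_eqI) auto
qed

lemma coth_transform_free_mult_conv:
  assumes \<sigma>: "is_free_mult_brownian t \<sigma>" and \<rho>: "is_free_mult_conv \<sigma> \<nu> \<rho>" and s: "Im s = pi"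
  shows "coth_transform (distr \<rho> borel ln) (s + of_real t * coth_transform (distr \<nu> borel ln) s)
    = coth_transform (distr \<nu> borel ln) s"
proof -
  have \<nu>: "prob_on_pos \<nu>" and \<rho>': "prob_on_pos \<rho>" using \<rho> by (auto simp: is_free_mult_conv_def)
  interpret D: real_distribution "distr \<nu> borel ln" by (rule real_distribution_distr_ln[OF \<nu>])
  define g where "g = coth_transform (distr \<nu> borel ln) s"
  define s' where "s' = s + of_real t * g"
  define h where "h = coth_transform (distr \<rho> borel ln) s'"
  define z where "z = eta_transform \<nu> (exp (- s))"
  have strip: "0 < Im s" "Im s < 2 * pi" using s by auto
  \<comment> \<open>On this line the transform \<open>g\<close> is real because
    \<open>sin pi = 0\<close>, so the shift stays on the line.\<close>
  have "Im s' = pi" using D.Im_coth_transform[OF strip] s by (simp add: s'_def g_def)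
  then have strip': "0 < Im s'" "Im s' < 2 * pi" by auto
  have zg: "z = (g - 1 / 2) / (g + 1 / 2)" unfolding z_def g_def by (rule eta_transform_exp[OF \<nu> strip])
  have z: "z \<in> neg_axis"
    unfolding z_def using bij_betw_apply[OF bij_betw_eta_transform[OF \<nu>] exp_minus_in_neg_axis[OF s]] .
  then have z0: "z \<noteq> 0" by (auto simp: neg_axis_def)
  then have g0: "g + 1 / 2 \<noteq> 0" using zg by auto
  have inv_\<nu>: "eta_inverse \<nu> z = exp (- s)"
    unfolding eta_inverse_def z_def
    using bij_betw_eta_transform[OF \<nu>] exp_minus_in_neg_axis[OF s] by (intro the_inv_into_f_f) (auto simp: bij_betw_def)
  have "(z + 1) / (z - 1) = - 2 * g"
  proof -
    define q where "q = g + 1 / 2"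
    have "z = (q - 1) / q" by (simp add: zg q_def)
    then have "z + 1 = (2 * q - 1) / q" "z - 1 = - 1 / q"
      using g0 by (simp_all add: q_def[symmetric] field_simps)
    then show ?thesis using g0 by (simp add: q_def[symmetric]) (simp add: q_def)
  qed
  moreover have "Sigma_transform \<sigma> z = exp (of_real (t / 2) * ((z + 1) / (z - 1)))"
    using \<sigma> z unfolding is_free_mult_brownian_def by blast
  ultimately have "Sigma_transform \<sigma> z = exp (- (of_real t * g))" by simp
  moreover have "Sigma_transform \<rho> z = Sigma_transform \<sigma> z * Sigma_transform \<nu> z"
    using \<rho> z unfolding is_free_mult_conv_def by blast
  ultimately have "eta_inverse \<rho> z / z = exp (- (of_real t * g)) * (exp (- s) / z)"
    by (simp only: Sigma_transform_def[of \<rho>] Sigma_transform_def[of \<nu>] inv_\<nu>)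
  then have "eta_inverse \<rho> z = exp (- s')"
    using z0 by (simp add: s'_def field_simps flip: exp_add)
  moreover have "eta_transform \<rho> (eta_inverse \<rho> z) = z"
    unfolding eta_inverse_def by (rule f_the_inv_into_f_bij_betw[OF bij_betw_eta_transform[OF \<rho>']]) (use z in auto)
  ultimately have zh: "z = (h - 1 / 2) / (h + 1 / 2)"
    unfolding h_def using eta_transform_exp[OF \<rho>' strip'] by simp
  then have "h + 1 / 2 \<noteq> 0" using z0 by auto
  \<comment> \<open>The map from \<open>g\<close> to \<open>(g - 1 / 2) / (g + 1 / 2)\<close> is
    injective, which cross-multiplication makes explicit.\<close>
  with zh zg g0 have "(h - 1 / 2) * (g + 1 / 2) = (g - 1 / 2) * (h + 1 / 2)"
    by (metis frac_eq_eq)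
  then have "h = g" by (simp add: algebra_simps)
  then show ?thesis by (simp add: h_def g_def s'_def)
qed

theorem theorem4p4:
  fixes \<alpha> \<beta> t :: real and \<nu> \<sigma> \<rho> :: "real measure"
  assumes "0 < \<alpha>" and "\<alpha> < \<beta>"
    and "\<beta> ^ 4 - 3 * \<alpha> ^ 4 < 2 * \<alpha> ^ 3 * \<beta>"
    and "real_distribution \<nu>" and "measure \<nu> {\<alpha>..\<beta>} = 1"
    and "t \<ge> D_const \<alpha> \<beta>"
    and "is_free_mult_brownian t \<sigma>"
    and "is_free_mult_conv \<sigma> \<nu> \<rho>"
  shows "log_unimodal \<rho>"
proof -
  have \<nu>: "prob_on_pos \<nu>" and \<rho>: "prob_on_pos \<rho>" using assms(8) by (auto simp: is_free_mult_conv_def)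
  interpret N: real_distribution \<nu> by fact
  interpret P: real_distribution \<rho> using \<rho> by (simp add: prob_on_pos_def)
  define M where "M = distr \<nu> borel ln"
  define R where "R = distr \<rho> borel ln"
  have "0 < t" using D_const_pos[OF assms(1-3)] assms(6) by linarith
  interpret M: real_distribution M unfolding M_def by (rule real_distribution_distr_ln[OF \<nu>])
  interpret free_brownian_flow M R t
  proof (intro free_brownian_flow.intro free_brownian_flow_axioms.intro M.real_distribution_axioms)
    show "real_distribution R" unfolding R_def by (rule real_distribution_distr_ln[OF \<rho>])
    show "coth_transform R (s + of_real t * coth_transform M s) = coth_transform M s" if "Im s = pi" for s
      unfolding R_def M_def by (rule coth_transform_free_mult_conv[OF assms(7,8) that])
  qed (fact \<open>0 < t\<close>)
  have supp: "AE y in M. exp y \<in> {\<alpha>..\<beta>}"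
  proof -
    have "AE x in \<nu>. x \<in> {\<alpha>..\<beta>}" using assms(5) by (subst N.prob_eq_1[symmetric]) auto
    then have "AE x in \<nu>. exp (ln x) \<in> {\<alpha>..\<beta>}" by eventually_elim (use assms(1) in auto)
    then show ?thesis unfolding M_def by (subst AE_distr_iff) auto
  qed
  have "\<exists>f. quasiconcave f \<and> (\<forall>x. 0 \<le> f x) \<and> f \<in> borel_measurable borel \<and>
      R = density lborel (\<lambda>x. ennreal (f x))"
    by (rule quasiconcave_density) (rule height_sublevel_convex[OF assms(1-3) supp assms(6)])
  then obtain f where f: "quasiconcave f" "\<And>x. 0 \<le> f x" "f \<in> borel_measurable borel"
      "R = density lborel (\<lambda>x. ennreal (f x))"
    by blast
  note [measurable] = f(3)
  have R_eq: "emeasure R A = (\<integral>\<^sup>+x. ennreal (f x) * indicator A x \<partial>lborel)" if "A \<in> sets borel" for A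
    using that by (simp add: f(4) emeasure_density)
  have "(\<integral>\<^sup>+x. ennreal (f x) \<partial>lborel) = 1"
    using R_eq[of UNIV] R.emeasure_space_1 by simp
  then obtain a where "monotone_on {..<a} (\<le>) (\<le>) f" "monotone_on {a<..} (\<le>) (\<ge>) f"
    using quasiconcave_density_unimodal[OF f(1,2)] by blast
  \<comment> \<open>\<open>R\<close> has a density, so the atom at the mode has weight
    \<open>c = 0\<close>.\<close>
  then have "unimodal_at a R"
    unfolding unimodal_at_def using R_eq f(2) by (auto intro!: exI[of _ 0] exI[of _ f])
  then have "log_unimodal_at (exp a) \<rho>"
    using \<rho> by (simp add: log_unimodal_at_def R_def prob_on_pos_def)
  then show ?thesis unfolding log_unimodal_def by blast
qed

end
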